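(* Let $(\mathscr{X},\Sigma,\mu)$ be a measure space with a basis $\mathscr{B}$, and let $T$ be either a linear or a linearizable operator acting on functions defined on $\mathscr{X}$. Fix $1\le p,q<\infty$, $\theta>0$, and $1<s<\infty$. Suppose that there exists an increasing function $\phi:[1,\infty)\to[0,\infty)$ such that for all weights $w$ with $w^\theta\in A_{s,\mathscr{B}}$ and each $f\in L^p(w^p)$, $$\|Tf\|_{L^q(w^q)}\le\phi\big([w^\theta]_{A_{s,\mathscr{B}}}\big)\,\|f\|_{L^p(w^p)}.$$ Then, for each $b\in\mathcal{BMO}_{\mathscr{B}}$ and for each weight $w$ and $1<\eta<\infty$ such that $w^{\theta\eta}\in A_{s,\mathscr{B}}$, we have $$\big\|[T,b]f\big\|_{L^q(w^q)}\le\frac{\eta'\,\theta}{\min\{1,s-1\}}\,\phi\Big(4^{\frac{\min\{1,s-1\}}{\eta'}}\,[w^{\theta\eta}]_{A_{s,\mathscr{B}}}^{1/\eta}\Big)\,\|b\|_{\mathcal{BMO}_{\mathscr{B}}}\,\|f\|_{L^p(w^p)};$$ and, for every $k\ge2$, $$\big\|T_b^kf\big\|_{L^q(w^q)}\le k!\Big(\frac{\eta'\,\theta}{\min\{1,s-1\}}\Big)^k\,\phi\Big(4^{\frac{\min\{1,s-1\}}{\eta'}}\,[w^{\theta\eta}]_{A_{s,\mathscr{B}}}^{1/\eta}\Big)\,\|b\|_{\mathcal{BMO}_{\mathscr{B}}}^k\,\|f\|_{L^p(w^p)},$$ where $\frac1\eta+\frac1{\eta'}=1$.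
   Context: $(\mathscr{X},\Sigma,\mu)$ is a measure space with $\mu$ non-negative. A basis $\mathscr{B}\subset\Sigma$ is a collection of measurable sets $B$ with $0<\mu(B)<\infty$. A weight is a non-negative function $w$ with $\int_B w\,d\mu<\infty$ for every $B\in\mathscr{B}$; $L^p(w)=L^p(w\,d\mu)$. For $1<s<\infty$, $w\in A_{s,\mathscr{B}}$ means $$[w]_{A_{s,\mathscr{B}}}:=\sup_{B\in\mathscr{B}}\Big(\frac1{\mu(B)}\int_B w\,d\mu\Big)\Big(\frac1{\mu(B)}\int_B w^{1-s'}\,d\mu\Big)^{s-1}<\infty,\qquad \tfrac1s+\tfrac1{s'}=1.$$ With $f_B=\frac1{\mu(B)}\int_B f\,d\mu$ and $\|f\|_{\exp L,B}:=\inf\{\lambda>0:\ \frac1{\mu(B)}\int_B e^{|f|/\lambda}\,d\mu\le2\}$, a measurable $f$ is in $\mathcal{BMO}_{\mathscr{B}}$ if $\int_B|f|\,d\mu<\infty$ for every $B\in\mathscr{B}$ and $\|f\|_{\mathcal{BMO}_{\mathscr{B}}}:=\sup_{B\in\mathscr{B}}\|f-f_B\|_{\exp L,B}<\infty$. Commutators (defined whenever they make sense): for linear $T$, $T_b^1f=[T,b]f=T(bf)-b\,Tf$ and $T_b^k=[T_b^{k-1},b]$ for $k\ge2$; equivalently $T_b^kf(x)=T\big((b(\cdot)-b(x))^kf(\cdot)\big)(x)$. A sublinear operator $T$ is linearizable if there exist a Banach space $\mathbb{B}$ and a $\mathbb{B}$-valued linear operator $\mathcal{T}$ such that $Tf(x)=\|\mathcal{T}f(x)\|_{\mathbb{B}}$;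 in that case $T_b^kf(x):=\|\mathcal{T}_b^kf(x)\|_{\mathbb{B}}$ and $[T,b]f:=T^1_bf$. *)

theory Defs
  imports "HOL-Analysis.Analysis"
begin

section \<open>Complex Banach spaces\<close>

class complex_banach = banach +
  fixes scaleC :: "complex \<Rightarrow> 'a \<Rightarrow> 'a"
  assumes scaleC_add_right: "scaleC c (x + y) = scaleC c x + scaleC c y"
    and scaleC_add_left: "scaleC (c + d) x = scaleC c x + scaleC d x"
    and scaleC_scaleC: "scaleC c (scaleC d x) = scaleC (c * d) x"
    and scaleC_of_real: "scaleC (of_real r) x = scaleR r x"
    and norm_scaleC: "norm (scaleC c x) = cmod c * norm x"

instantiation complex :: complex_banach
begin
definition scaleC_complex_def [simp]: "scaleC c (z::complex) = c * z"
instance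
  by standard (simp_all add: algebra_simps norm_mult scaleR_conv_of_real)
end

section \<open>Powers and averages\<close>

text \<open>Real powers on \<open>[0, \<infinity>]\<close>, with \<open>0\<close> to a negative power equal to \<open>\<infinity>\<close>
  (whereas \<open>0 powr a = 0\<close> for real numbers, whatever the sign of \<open>a\<close>).\<close>

definition epowr :: "ennreal \<Rightarrow> real \<Rightarrow> ennreal" where
  "epowr x a =
    (if a = 0 then 1
     else if (x = 0 \<and> a < 0) \<or> (x = \<infinity> \<and> a > 0) then \<infinity>
     else ennreal (enn2real x powr a))"

definition nn_avg :: "'a measure \<Rightarrow> 'a set \<Rightarrow> ('a \<Rightarrow> ennreal) \<Rightarrow> ennreal" where
  "nn_avg M B g = (\<integral>\<^sup>+x\<in>B. g x \<partial>M) / emeasure M B"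

definition avg :: "'a measure \<Rightarrow> 'a set \<Rightarrow> ('a \<Rightarrow> complex) \<Rightarrow> complex" where
  "avg M B f = (LINT x:B|M. f x) / of_real (measure M B)"

definition conjugate_exponent :: "real \<Rightarrow> real" where
  "conjugate_exponent s = s / (s - 1)"

lemma conjugate_exponent: "s > 1 \<Longrightarrow> 1 / s + 1 / conjugate_exponent s = 1"
  by (simp add: conjugate_exponent_def field_simps)

section \<open>Weights and Muckenhoupt classes relative to a basis\<close>

definition is_basis :: "'a measure \<Rightarrow> 'a set set \<Rightarrow> bool" where
  "is_basis M \<B> \<longleftrightarrow> \<B> \<subseteq> sets M \<and> (\<forall>B\<in>\<B>. 0 < emeasure M B \<and> emeasure M B < \<infinity>)"

definition weight :: "'a measure \<Rightarrow> 'a set set \<Rightarrow> ('a \<Rightarrow> real) \<Rightarrow> bool" where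
  "weight M \<B> w \<longleftrightarrow> w \<in> borel_measurable M \<and> (\<forall>x\<in>space M. 0 \<le> w x) \<and>
     (\<forall>B\<in>\<B>. (\<integral>\<^sup>+x\<in>B. ennreal (w x) \<partial>M) < \<infinity>)"

text \<open>The convention is that the product is \<open>\<infinity>\<close> as soon as its second factor is, even if
  \<open>w\<close> vanishes almost everywhere on \<open>B\<close> (in \<^typ>\<open>ennreal\<close> one has \<open>0 * \<infinity> = 0\<close>).  So a
  weight in the class is positive almost everywhere on each \<open>B\<close>, and its constant is at
  least \<open>1\<close> by Hoelder's inequality.\<close>

definition Muckenhoupt_const ::
  "'a measure \<Rightarrow> 'a set set \<Rightarrow> real \<Rightarrow> ('a \<Rightarrow> real) \<Rightarrow> ennreal" where
  "Muckenhoupt_const M \<B> s w =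
    (SUP B\<in>\<B>.
      let \<sigma> = nn_avg M B (\<lambda>x. epowr (ennreal (w x)) (1 - conjugate_exponent s))
      in if \<sigma> = \<infinity> then \<infinity> else nn_avg M B (\<lambda>x. ennreal (w x)) * epowr \<sigma> (s - 1))"

definition Muckenhoupt ::
  "'a measure \<Rightarrow> 'a set set \<Rightarrow> real \<Rightarrow> ('a \<Rightarrow> real) set" where
  "Muckenhoupt M \<B> s = {w. weight M \<B> w \<and> Muckenhoupt_const M \<B> s w < \<infinity>}"

section \<open>Weighted Lebesgue spaces\<close>

text \<open>The norm of \<open>L\<^sup>p(v d\<mu>)\<close>, with value \<open>\<infinity>\<close> off the space.\<close>

definition Lp_norm ::
  "'a measure \<Rightarrow> real \<Rightarrow> ('a \<Rightarrow> real) \<Rightarrow> ('a \<Rightarrow> complex) \<Rightarrow> ennreal" where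
  "Lp_norm M p v f =
    epowr (\<integral>\<^sup>+x. ennreal (norm (f x) powr p) \<partial>density M (\<lambda>x. ennreal (v x))) (1 / p)"

definition Lp :: "'a measure \<Rightarrow> real \<Rightarrow> ('a \<Rightarrow> real) \<Rightarrow> ('a \<Rightarrow> complex) set" where
  "Lp M p v = {f \<in> borel_measurable M. Lp_norm M p v f < \<infinity>}"

section \<open>Exponential BMO relative to a basis\<close>

definition expL_norm :: "'a measure \<Rightarrow> 'a set \<Rightarrow> ('a \<Rightarrow> complex) \<Rightarrow> ennreal" where
  "expL_norm M B f =
    (INF t\<in>{t::real. 0 < t \<and> nn_avg M B (\<lambda>x. ennreal (exp (norm (f x) / t))) \<le> 2}. ennreal t)"

definition BMO_norm :: "'a measure \<Rightarrow> 'a set set \<Rightarrow> ('a \<Rightarrow> complex) \<Rightarrow> ennreal" where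
  "BMO_norm M \<B> f = (SUP B\<in>\<B>. expL_norm M B (\<lambda>x. f x - avg M B f))"

definition BMO :: "'a measure \<Rightarrow> 'a set set \<Rightarrow> ('a \<Rightarrow> complex) set" where
  "BMO M \<B> = {f \<in> borel_measurable M.
     (\<forall>B\<in>\<B>. set_integrable M B f) \<and> BMO_norm M \<B> f < \<infinity>}"

section \<open>Linear and linearizable operators and their commutators\<close>

text \<open>Operators are only defined on a linear space \<open>D\<close> of functions, and are linear up to
  null sets, since their values are functions defined almost everywhere.\<close>

definition function_space :: "('a \<Rightarrow> complex) set \<Rightarrow> bool" where
  "function_space D \<longleftrightarrow> (\<lambda>x. 0) \<in> D \<and>
     (\<forall>f\<in>D. \<forall>g\<in>D. (\<lambda>x. f x + g x) \<in> D) \<and> (\<forall>c. \<forall>f\<in>D. (\<lambda>x. c * f x) \<in> D)"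

definition linear_operator ::
  "'a measure \<Rightarrow> ('a \<Rightarrow> complex) set \<Rightarrow> (('a \<Rightarrow> complex) \<Rightarrow> 'a \<Rightarrow> 'v::complex_banach) \<Rightarrow> bool"
where
  "linear_operator M D S \<longleftrightarrow> function_space D \<and>
     (\<forall>f\<in>D. \<forall>g\<in>D. AE x in M. S (\<lambda>y. f y + g y) x = S f x + S g x) \<and>
     (\<forall>c. \<forall>f\<in>D. AE x in M. S (\<lambda>y. c * f y) x = scaleC c (S f x))"

text \<open>Sublinearity of \<open>T\<close> is a consequence and is not repeated.\<close>

definition linearization ::
  "'a measure \<Rightarrow> ('a \<Rightarrow> complex) set \<Rightarrow> (('a \<Rightarrow> complex) \<Rightarrow> 'a \<Rightarrow> 'v::complex_banach) \<Rightarrow>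
    (('a \<Rightarrow> complex) \<Rightarrow> 'a \<Rightarrow> complex) \<Rightarrow> bool"
where
  "linearization M D \<T> T \<longleftrightarrow> linear_operator M D \<T> \<and>
     (\<forall>f\<in>D. AE x in M. T f x = of_real (norm (\<T> f x)))"

definition commutator ::
  "('a \<Rightarrow> complex) \<Rightarrow> (('a \<Rightarrow> complex) \<Rightarrow> 'a \<Rightarrow> 'v::complex_banach) \<Rightarrow>
    ('a \<Rightarrow> complex) \<Rightarrow> 'a \<Rightarrow> 'v"
where
  "commutator b S f = (\<lambda>x. S (\<lambda>y. b y * f y) x - scaleC (b x) (S f x))"

primrec iter_commutator ::
  "('a \<Rightarrow> complex) \<Rightarrow> nat \<Rightarrow> (('a \<Rightarrow> complex) \<Rightarrow> 'a \<Rightarrow> 'v::complex_banach) \<Rightarrow>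
    ('a \<Rightarrow> complex) \<Rightarrow> 'a \<Rightarrow> 'v"
where
  "iter_commutator b 0 S = S"
| "iter_commutator b (Suc k) S = commutator b (iter_commutator b k S)"

end

theory Submission
  imports Defs
begin

text \<open>
  With \<open>T\<^sub>z f = exp (- z b) T (exp (z b) f)\<close>, the commutator \<open>T\<^sub>b\<^sup>k f\<close> is \<open>k!\<close> times the \<open>k\<close>-th Taylor coefficient
  of \<open>T\<^sub>z f\<close> at \<open>z = 0\<close>, and \<open>T\<^sub>z\<close> is bounded on the \<open>w\<close>-weighted spaces as soon as \<open>T\<close> is bounded for
  the weight \<open>w exp (- Re (z b))\<close>.  By Hoelder's inequality with exponents \<open>\<eta>, \<eta>'\<close> and the exponential
  integrability of \<open>b\<close>, this is so for \<open>\<bar>z\<bar> \<le> min 1 (s - 1) / (\<theta> \<eta>' t)\<close> whenever \<open>t\<close> exceeds the BMO norm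
  of \<open>b\<close>; Cauchy's estimate then gives the theorem.

  Since the values of \<open>\<T>\<close> need not be measurable in \<open>x\<close> or \<open>z\<close>, the contour integral is replaced by averages
  over \<open>N\<close>-th roots of unity, applied to Taylor polynomials of \<open>exp (z b) f\<close>, and limits are taken by Fatou's
  lemma for measurable majorants only.  Since \<open>w exp (- Re (z b))\<close> need not be locally integrable, the
  exponent uses the projection of \<open>b\<close> to a large disc, which does not increase oscillations; the error
  terms are measured with the smaller weight \<open>w exp (- \<rho> \<bar>b\<bar>)\<close>.
\<close>

section \<open>Cauchy coefficient extraction by averages over roots of unity\<close>

text \<open>The nodes of the trapezoidal rule for contour integrals over the circle of radius
  \<open>r\<close>; for \<open>N = 0\<close> every node is \<open>r\<close>, since division by zero
  gives zero.\<close>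

definition circle_point :: "real \<Rightarrow> nat \<Rightarrow> nat \<Rightarrow> complex" where
  "circle_point r N j = of_real r * exp (2 * of_real pi * \<i> * of_nat j / of_nat N)"

lemma norm_circle_point [simp]: "0 \<le> r \<Longrightarrow> norm (circle_point r N j) = r"
  by (simp add: circle_point_def norm_mult)

text \<open>Orthogonality of the characters of the cyclic group of order \<open>N\<close>: with the
  powers of \<open>r\<close> pulled out, this is a geometric sum whose ratio \<open>\<xi>\<close> is
  an \<open>N\<close>-th root of unity. Both exponents lie below \<open>N\<close>, so
  \<open>\<xi> = 1\<close> only for \<open>i = k\<close>.\<close>

lemma sum_circle_point_powers:
  assumes "0 < r" "i < N" "k < N"
  shows "(\<Sum>j<N. circle_point r N j ^ i / circle_point r N j ^ k)
    = (if i = k then of_nat N else 0)"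
proof -
  define \<omega> where "\<omega> j = exp (2 * of_real pi * \<i> * of_nat j / of_nat N)" for j
  have \<omega>_pow: "\<omega> j ^ m = \<omega> (j * m)" for j m
    unfolding \<omega>_def exp_of_nat_mult[symmetric] by (simp add: algebra_simps)
  define \<xi> where "\<xi> = \<omega> i / \<omega> k"
  have term_eq: "circle_point r N j ^ i / circle_point r N j ^ k = of_real r ^ i / of_real r ^ k * \<xi> ^ j" for j
  proof -
    have "circle_point r N j = of_real r * \<omega> j" by (simp add: circle_point_def \<omega>_def)
    then show ?thesis
      by (simp add: power_mult_distrib \<xi>_def power_divide \<omega>_pow mult.commute)
  qed
  show ?thesis
  proof (cases "i = k")
    case True
    have "circle_point r N j \<noteq> 0" for j
      using assms(1) by (simp add: circle_point_def)
    then show ?thesis using True by simp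
  next
    case False
    have "\<omega> i \<noteq> \<omega> k"
      unfolding \<omega>_def using assms False by (subst complex_root_unity_eq) auto
    moreover have "\<omega> k \<noteq> 0" by (simp add: \<omega>_def)
    ultimately have "\<xi> \<noteq> 1" by (simp add: \<xi>_def)
    moreover have "\<xi> ^ N = 1"
    proof -
      have "\<omega> j ^ N = 1" for j
        unfolding \<omega>_def using assms by (intro complex_root_unity) auto
      then show ?thesis by (simp add: \<xi>_def power_divide)
    qed
    ultimately have "(\<Sum>j<N. \<xi> ^ j) = 0" by (simp add: sum_gp_strict)
    then show ?thesis
      using False unfolding term_eq sum_distrib_left[symmetric] by simp
  qed
qed

text \<open>Discrete form of Cauchy's coefficient formula. Each index other than \<open>k\<close>
  drops out of the average once \<open>N\<close> is large, and Tannery's theorem passes to the limit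
  under the sum with majorant \<open>norm (a i) * r ^ i / r ^ k\<close>.\<close>

lemma circle_average_tendsto_coeff:
  fixes a :: "nat \<Rightarrow> complex"
  assumes r: "0 < r" and summable: "summable (\<lambda>i. norm (a i) * r ^ i)"
    and h: "\<And>z. norm z = r \<Longrightarrow> (\<lambda>i. a i * z ^ i) sums h z"
  shows "(\<lambda>N. (\<Sum>j<N. h (circle_point r N j) / circle_point r N j ^ k) / of_nat N) \<longlonglongrightarrow> a k"
proof -
  define c where "c i N = a i * ((\<Sum>j<N. circle_point r N j ^ i / circle_point r N j ^ k) / of_nat N)" for i N
  have lim: "(\<lambda>N. c i N) \<longlonglongrightarrow> (if i = k then a k else 0)" for i
  proof (rule tendsto_eventually)
    show "\<forall>\<^sub>F N in sequentially. c i N = (if i = k then a k else 0)"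
      using eventually_gt_at_top[of "max i k"]
      by eventually_elim (simp add: c_def sum_circle_point_powers r)
  qed
  have bound: "norm (c i N) \<le> norm (a i) * r ^ i * (1 / r ^ k)" for i N
  proof -
    have "norm (\<Sum>j<N. circle_point r N j ^ i / circle_point r N j ^ k) \<le> (\<Sum>j<N. r ^ i / r ^ k)"
      using r by (intro sum_norm_le) (simp add: norm_divide norm_power)
    then have "norm ((\<Sum>j<N. circle_point r N j ^ i / circle_point r N j ^ k) / of_nat N) \<le> r ^ i / r ^ k"
      using r by (cases "N = 0") (simp_all add: norm_divide field_simps)
    then show ?thesis
      unfolding c_def norm_mult using mult_left_mono[of _ _ "norm (a i)"] by fastforce
  qed
  have "(\<lambda>N. \<Sum>i. c i N) \<longlonglongrightarrow> (\<Sum>i. if i = k then a k else 0)"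
    by (rule tannerys_theorem[THEN conjunct2, THEN conjunct2, OF lim _ summable_mult2[OF summable, of "1 / r ^ k"]])
      (auto intro!: always_eventually bound[simplified])
  moreover have "(\<Sum>i. if i = k then a k else 0) = a k"
    using sums_unique[OF sums_single[of k a]] by (simp cong: if_cong)
  moreover have "(\<Sum>i. c i N) = (\<Sum>j<N. h (circle_point r N j) / circle_point r N j ^ k) / of_nat N" for N
  proof (rule sums_unique[symmetric])
    have "(\<lambda>i. (\<Sum>j<N. a i * circle_point r N j ^ i / circle_point r N j ^ k) / of_nat N) sums
      ((\<Sum>j<N. h (circle_point r N j) / circle_point r N j ^ k) / of_nat N)"
      using r by (intro sums_divide sums_sum h) simp
    then show "(\<lambda>i. c i N) sums ((\<Sum>j<N. h (circle_point r N j) / circle_point r N j ^ k) / of_nat N)"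
      by (simp add: c_def sum_distrib_left)
  qed
  ultimately show ?thesis by simp
qed

text \<open>Multiplication by \<open>z ^ m\<close> shifts the Taylor coefficients of
  \<open>exp (z * \<beta>)\<close> by \<open>m\<close>; the limit is the shifted coefficient of
  index \<open>k\<close>.\<close>

lemma circle_average_exp:
  fixes \<beta> :: complex
  assumes r: "0 < r"
  shows "(\<lambda>N. (\<Sum>j<N. circle_point r N j ^ m * exp (circle_point r N j * \<beta>) / circle_point r N j ^ k) / of_nat N)
    \<longlonglongrightarrow> (if m \<le> k then \<beta> ^ (k - m) / fact (k - m) else 0)"
proof -
  define a where "a i = (if i < m then 0 else \<beta> ^ (i - m) / fact (i - m))" for i
  have shift: "(\<lambda>i. if i < m then 0 else f (i - m)) sums x" if "f sums x" for f :: "nat \<Rightarrow> 'c::real_normed_vector" and x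
    using that sums_iff_shift[of "\<lambda>i. if i < m then 0 else f (i - m)" m x] by simp
  have a: "(\<lambda>i. a i * z ^ i) sums (z ^ m * exp (z * \<beta>))" for z
  proof -
    have "(\<lambda>i. z ^ m * ((z * \<beta>) ^ i /\<^sub>R fact i)) sums (z ^ m * exp (z * \<beta>))"
      by (intro sums_mult exp_converges)
    from shift[OF this] show ?thesis
      by (rule sums_cong[THEN iffD1, rotated])
        (auto simp: a_def scaleR_conv_of_real power_mult_distrib field_simps not_less
          simp flip: power_add)
  qed
  have "(\<lambda>i. r ^ m * ((r * norm \<beta>) ^ i /\<^sub>R fact i)) sums (r ^ m * exp (r * norm \<beta>))"
    by (intro sums_mult exp_converges)
  from shift[OF this] have "(\<lambda>i. norm (a i) * r ^ i) sums (r ^ m * exp (r * norm \<beta>))"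
    by (rule sums_cong[THEN iffD1, rotated])
      (auto simp: a_def power_mult_distrib norm_divide norm_power field_simps not_less
        simp flip: power_add)
  then have "(\<lambda>N. (\<Sum>j<N. circle_point r N j ^ m * exp (circle_point r N j * \<beta>) / circle_point r N j ^ k) / of_nat N)
    \<longlonglongrightarrow> a k"
    by (intro circle_average_tendsto_coeff a r) (auto simp: sums_iff)
  then show ?thesis by (auto simp: a_def not_less split: if_splits)
qed

section \<open>Iterated commutators\<close>

lemma scaleC_zero_right [simp]: "scaleC c (0::'v::complex_banach) = 0"
  by (metis add_cancel_left_left scaleC_add_right)

lemma scaleC_zero_left [simp]: "scaleC 0 (x::'v::complex_banach) = 0"
  by (metis add_cancel_left_left scaleC_add_left)

lemma scaleC_one [simp]: "scaleC 1 (x::'v::complex_banach) = x"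
  by (metis of_real_1 scaleC_of_real scaleR_one)

lemma scaleC_minus_left: "scaleC (- c) (x::'v::complex_banach) = - scaleC c x"
  by (metis add.right_inverse minus_unique scaleC_add_left scaleC_zero_left)

lemma scaleC_diff_left: "scaleC (c - d) (x::'v::complex_banach) = scaleC c x - scaleC d x"
  by (metis add_diff_cancel diff_add_cancel scaleC_add_left)

lemma scaleC_sum_right: "scaleC c (\<Sum>i\<in>I. f i) = (\<Sum>i\<in>I. scaleC c (f i :: 'v::complex_banach))"
  by (induction I rule: infinite_finite_induct) (simp_all add: scaleC_add_right)

lemma scaleC_sum_left: "scaleC (\<Sum>i\<in>I. f i) (x::'v::complex_banach) = (\<Sum>i\<in>I. scaleC (f i) x)"
  by (induction I rule: infinite_finite_induct) (simp_all add: scaleC_add_left)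

lemma tendsto_scaleC_left:
  assumes "(f \<longlongrightarrow> c) F"
  shows "((\<lambda>n. scaleC (f n) (x::'v::complex_banach)) \<longlongrightarrow> scaleC c x) F"
proof -
  have "((\<lambda>n. cmod (f n - c) * norm x) \<longlongrightarrow> 0) F"
    using assms by (intro tendsto_mult_left_zero) (simp add: tendsto_norm_zero_iff LIM_zero)
  then have "((\<lambda>n. scaleC (f n) x - scaleC c x) \<longlongrightarrow> 0) F"
    by (simp add: tendsto_norm_zero_iff flip: norm_scaleC scaleC_diff_left)
  then show ?thesis by (rule LIM_zero_cancel)
qed

lemma iter_commutator_Suc_shift:
  "iter_commutator b (Suc k) S f x
    = iter_commutator b k S (\<lambda>y. b y * f y) x - scaleC (b x) (iter_commutator b k S f x)"
  by (simp add: commutator_def)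

text \<open>Induction with Pascal's rule, where the step uses the hypothesis for both
  \<open>f\<close> and \<open>b f\<close>. The identity holds at every \<open>x\<close>, without
  exceptional null sets, because it only unfolds the recursion and moves scalars in the target
  space.\<close>

lemma iter_commutator_expand:
  fixes S :: "('a \<Rightarrow> complex) \<Rightarrow> 'a \<Rightarrow> 'v::complex_banach"
  shows "iter_commutator b k S f x
    = (\<Sum>m\<le>k. scaleC (of_nat (k choose m) * (- b x) ^ (k - m)) (S (\<lambda>y. b y ^ m * f y) x))"
proof (induction k arbitrary: f)
  case 0
  then show ?case by simp
next
  case (Suc k)
  define V where "V m = S (\<lambda>y. b y ^ m * f y) x" for m
  have V: "S (\<lambda>y. b y ^ m * (b y * f y)) x = V (Suc m)" for m
    by (simp add: V_def mult_ac)
  have "iter_commutator b (Suc k) S f x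
     = (\<Sum>m\<le>k. scaleC (of_nat (k choose m) * (- b x) ^ (k - m)) (V (Suc m)))
     + (\<Sum>m\<le>k. scaleC (of_nat (k choose m) * (- b x) ^ (Suc k - m)) (V m))"
    unfolding iter_commutator_Suc_shift Suc V V_def[symmetric]
    by (simp add: scaleC_sum_right scaleC_scaleC Suc_diff_le mult_ac diff_conv_add_uminus
        flip: scaleC_minus_left sum_negf del: add_uminus_conv_diff)
  \<comment> \<open>The added term with \<open>m = Suc k\<close> is zero; it allows the reindexing
    that pairs this sum with the other one for Pascal's rule.\<close>
  also have "(\<Sum>m\<le>k. scaleC (of_nat (k choose m) * (- b x) ^ (Suc k - m)) (V m))
     = (\<Sum>m\<le>Suc k. scaleC (of_nat (k choose m) * (- b x) ^ (Suc k - m)) (V m))"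
    by (simp add: binomial_eq_0)
  also have "\<dots> = scaleC ((- b x) ^ Suc k) (V 0)
      + (\<Sum>m\<le>k. scaleC (of_nat (k choose Suc m) * (- b x) ^ (k - m)) (V (Suc m)))"
    by (subst sum.atMost_Suc_shift) simp
  also have "(\<Sum>m\<le>k. scaleC (of_nat (k choose m) * (- b x) ^ (k - m)) (V (Suc m))) + \<dots>
    = scaleC ((- b x) ^ Suc k) (V 0)
      + (\<Sum>m\<le>k. scaleC (of_nat (Suc k choose Suc m) * (- b x) ^ (k - m)) (V (Suc m)))"
    by (simp add: sum.distrib scaleC_add_left algebra_simps)
  also have "\<dots> = (\<Sum>m\<le>Suc k. scaleC (of_nat (Suc k choose m) * (- b x) ^ (Suc k - m)) (V m))"
    unfolding sum.atMost_Suc_shift[of _ k] by simp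
  finally show ?case by (simp add: V_def)
qed

text \<open>The inner sum is formally the image under \<open>S\<close> of the Taylor polynomial of
  degree \<open>n\<close> of \<open>exp (z b) f\<close>. Only finitely many fixed vectors
  \<open>V m\<close> occur, so the limit is taken in their scalar coefficients;
  \<open>k \<le> n\<close> ensures that every term of \<open>iter_commutator_expand\<close> is
  present.\<close>

lemma circle_average_iter_commutator:
  fixes S :: "('a \<Rightarrow> complex) \<Rightarrow> 'a \<Rightarrow> 'v::complex_banach"
  assumes r: "0 < r" and "k \<le> n"
  shows "(\<lambda>N. \<Sum>j<N. scaleC (exp (- circle_point r N j * b x) / circle_point r N j ^ k / of_nat N)
      (\<Sum>m\<le>n. scaleC (circle_point r N j ^ m / fact m) (S (\<lambda>y. b y ^ m * f y) x)))
    \<longlonglongrightarrow> scaleC (1 / fact k) (iter_commutator b k S f x)"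
proof -
  define V where "V m = S (\<lambda>y. b y ^ m * f y) x" for m
  define c where "c m N = (\<Sum>j<N. circle_point r N j ^ m * exp (circle_point r N j * (- b x)) / circle_point r N j ^ k) / of_nat N" for m N
  have "(\<lambda>N. \<Sum>m\<le>n. scaleC (c m N / fact m) (V m)) \<longlonglongrightarrow>
      (\<Sum>m\<le>n. scaleC ((if m \<le> k then (- b x) ^ (k - m) / fact (k - m) else 0) / fact m) (V m))"
    unfolding c_def by (intro tendsto_sum tendsto_scaleC_left tendsto_divide tendsto_const circle_average_exp r) simp
  moreover have "(\<Sum>m\<le>n. scaleC ((if m \<le> k then (- b x) ^ (k - m) / fact (k - m) else 0) / fact m) (V m))
    = scaleC (1 / fact k) (iter_commutator b k S f x)"
  proof -
    have "scaleC (1 / fact k) (iter_commutator b k S f x)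
      = (\<Sum>m\<le>k. scaleC ((- b x) ^ (k - m) / fact (k - m) / fact m) (V m))"
      unfolding iter_commutator_expand scaleC_sum_right scaleC_scaleC V_def
      by (intro sum.cong refl) (simp add: binomial_fact field_simps)
    also have "\<dots> = (\<Sum>m\<le>n. scaleC ((if m \<le> k then (- b x) ^ (k - m) / fact (k - m) else 0) / fact m) (V m))"
      using assms(2) by (intro sum.mono_neutral_cong_left) auto
    finally show ?thesis by simp
  qed
  moreover have "(\<Sum>m\<le>n. scaleC (c m N / fact m) (V m))
    = (\<Sum>j<N. scaleC (exp (- circle_point r N j * b x) / circle_point r N j ^ k / of_nat N)
      (\<Sum>m\<le>n. scaleC (circle_point r N j ^ m / fact m) (V m)))" for N
    unfolding c_def scaleC_sum_right scaleC_scaleC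
    apply (subst sum.swap)
    apply (simp add: sum_divide_distrib scaleC_sum_left)
    apply (intro sum.cong refl arg_cong2[where f=scaleC])
    apply (simp add: field_simps)
    done
  ultimately show ?thesis by (simp add: V_def)
qed

section \<open>Integral inequalities\<close>

text \<open>When \<open>x\<close> or \<open>y\<close> is zero, convexity reduces to
  \<open>c powr q \<le> c\<close> for \<open>c\<close> in the unit interval; otherwise it is
  convexity on the positive half-line.\<close>

lemma convex_on_powr_nonneg:
  fixes q :: real
  assumes "1 \<le> q"
  shows "convex_on {0..} (\<lambda>x. x powr q)"
proof (rule convex_onI)
  fix t x y :: real
  assume t: "0 < t" "t < 1" and xy: "x \<in> {0..}" "y \<in> {0..}"
  have small: "c powr q \<le> c" if "0 \<le> c" "c \<le> 1" for c :: real
    using that assms powr_mono'[of 1 q c] by (cases "c = 0") auto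
  consider "x = 0" | "y = 0" | "0 < x" "0 < y" using xy by force
  then show "((1 - t) *\<^sub>R x + t *\<^sub>R y) powr q \<le> (1 - t) * x powr q + t * y powr q"
  proof cases
    case 1
    then show ?thesis using t xy small[of t] by (simp add: powr_mult mult_right_mono)
  next
    case 2
    then show ?thesis using t xy small[of "1 - t"] by (simp add: powr_mult mult_right_mono)
  next
    case 3
    then show ?thesis using convex_onD[OF powr_convex[OF assms], of t x y] t by simp
  qed
qed simp

text \<open>Minkowski's inequality for averages: Jensen's inequality handles the mean over
  \<open>j\<close>, and splitting each sum with the weights \<open>A / (A + E)\<close> and
  \<open>E / (A + E)\<close> makes the two parts add up to the power of
  \<open>A + E\<close>.\<close>

lemma nn_integral_mean_powr_le:
  fixes \<alpha> \<beta> :: "nat \<Rightarrow> 'a \<Rightarrow> real"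
  assumes q: "1 \<le> q" and pos: "0 < A" "0 < E" "0 < N"
    and meas [measurable]: "\<And>j. j < N \<Longrightarrow> \<alpha> j \<in> borel_measurable M" "\<And>j. j < N \<Longrightarrow> \<beta> j \<in> borel_measurable M"
    and nonneg: "\<And>j x. j < N \<Longrightarrow> x \<in> space M \<Longrightarrow> 0 \<le> \<alpha> j x" "\<And>j x. j < N \<Longrightarrow> x \<in> space M \<Longrightarrow> 0 \<le> \<beta> j x"
    and \<alpha>: "\<And>j. j < N \<Longrightarrow> (\<integral>\<^sup>+x. ennreal (\<alpha> j x powr q) \<partial>M) \<le> ennreal (A powr q)"
    and \<beta>: "\<And>j. j < N \<Longrightarrow> (\<integral>\<^sup>+x. ennreal (\<beta> j x powr q) \<partial>M) \<le> ennreal (E powr q)"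
  shows "(\<integral>\<^sup>+x. ennreal (((\<Sum>j<N. \<alpha> j x + \<beta> j x) / N) powr q) \<partial>M) \<le> ennreal ((A + E) powr q)"
proof -
  \<comment> \<open>Chosen so that the bound \<open>two\<close> is an equality at
    \<open>a = A\<close>, \<open>b = E\<close>; the factor \<open>1 / N\<close> comes from Jensen's
    inequality over \<open>j\<close>.\<close>
  define c where "c = (A + E) powr q / (A + E) * (A / A powr q) / N"
  define d where "d = (A + E) powr q / (A + E) * (E / E powr q) / N"
  have cd: "0 \<le> c" "0 \<le> d" using pos by (auto simp: c_def d_def)
  have conv: "convex_on {0..} (\<lambda>x. x powr q)" by (rule convex_on_powr_nonneg[OF q])
  have two: "(a + b) powr q / N \<le> c * a powr q + d * b powr q" if "0 \<le> a" "0 \<le> b" for a b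
  proof -
    have "((1 - E / (A + E)) * (a / A) + E / (A + E) * (b / E)) powr q
      \<le> (1 - E / (A + E)) * (a / A) powr q + E / (A + E) * (b / E) powr q"
      using convex_onD[OF conv, of "E / (A + E)" "a / A" "b / E"] pos that by simp
    then have "(A + E) powr q * ((1 - E / (A + E)) * (a / A) + E / (A + E) * (b / E)) powr q / N
      \<le> (A + E) powr q * ((1 - E / (A + E)) * (a / A) powr q + E / (A + E) * (b / E) powr q) / N"
      using pos by (intro divide_right_mono mult_left_mono) auto
    also have "1 - E / (A + E) = A / (A + E)"
      using pos by (simp add: field_simps)
    also have "(A + E) powr q * (A / (A + E) * (a / A) powr q + E / (A + E) * (b / E) powr q) / N
       = c * a powr q + d * b powr q"
      using pos that by (simp add: c_def d_def powr_divide distrib_left add_divide_distrib mult_ac)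
    also have "(A + E) powr q * (A / (A + E) * (a / A) + E / (A + E) * (b / E)) powr q = (a + b) powr q"
    proof -
      have "0 \<le> A / (A + E) * (a / A) + E / (A + E) * (b / E)" using pos that by simp
      moreover have "(A + E) * (A / (A + E) * (a / A) + E / (A + E) * (b / E)) = a + b"
        using pos by (simp flip: add_divide_distrib)
      ultimately show ?thesis
        using pos by (metis add_nonneg_nonneg less_imp_le powr_mult)
    qed
    finally show ?thesis .
  qed
  have "((\<Sum>j<N. \<alpha> j x + \<beta> j x) / N) powr q \<le> (\<Sum>j<N. c * \<alpha> j x powr q + d * \<beta> j x powr q)"
    if x: "x \<in> space M" for x
  proof -
    have "(\<Sum>j<N. (1 / N) *\<^sub>R (\<alpha> j x + \<beta> j x)) powr q \<le> (\<Sum>j<N. (1 / N) * (\<alpha> j x + \<beta> j x) powr q)"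
      using pos x nonneg by (intro convex_on_sum[OF _ _ conv]) auto
    also have "\<dots> \<le> (\<Sum>j<N. c * \<alpha> j x powr q + d * \<beta> j x powr q)"
      using two x nonneg by (intro sum_mono) auto
    finally show ?thesis by (simp add: sum_divide_distrib)
  qed
  then have "(\<integral>\<^sup>+x. ennreal (((\<Sum>j<N. \<alpha> j x + \<beta> j x) / N) powr q) \<partial>M)
      \<le> (\<integral>\<^sup>+x. (\<Sum>j<N. ennreal c * ennreal (\<alpha> j x powr q) + ennreal d * ennreal (\<beta> j x powr q)) \<partial>M)"
    using cd by (intro nn_integral_mono) (simp add: sum_ennreal ennreal_leI flip: ennreal_mult ennreal_plus)
  also have "\<dots> = (\<Sum>j<N. ennreal c * (\<integral>\<^sup>+x. ennreal (\<alpha> j x powr q) \<partial>M) + ennreal d * (\<integral>\<^sup>+x. ennreal (\<beta> j x powr q) \<partial>M))"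
    by (subst nn_integral_sum) (auto simp: nn_integral_add nn_integral_cmult intro!: sum.cong)
  also have "\<dots> \<le> (\<Sum>j<N. ennreal c * ennreal (A powr q) + ennreal d * ennreal (E powr q))"
    using \<alpha> \<beta> by (intro sum_mono add_mono mult_left_mono) auto
  also have "\<dots> = ennreal (\<Sum>j<N. c * A powr q + d * E powr q)"
    using cd by (simp add: ennreal_mult ennreal_plus del: sum_constant flip: sum_ennreal)
  also have "(\<Sum>j<N. c * A powr q + d * E powr q) = (A + E) powr q"
  proof -
    have "N * (c * A powr q) = (A + E) powr q * (A / (A + E))"
      "N * (d * E powr q) = (A + E) powr q * (E / (A + E))"
      using pos by (simp_all add: c_def d_def)
    then have "(\<Sum>j<N. c * A powr q + d * E powr q) = (A + E) powr q * (A / (A + E)) + (A + E) powr q * (E / (A + E))"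
      by (simp add: distrib_left)
    also have "\<dots> = (A + E) powr q * ((A + E) / (A + E))"
      by (simp only: add_divide_distrib distrib_left)
    finally show ?thesis using pos by simp
  qed
  finally show ?thesis .
qed

text \<open>Young's inequality for \<open>u / A\<close> and \<open>v / C\<close>, integrated. The
  exponents are the reciprocals of the usual ones.\<close>

lemma nn_integral_Hoelder:
  fixes u v :: "'a \<Rightarrow> real"
  assumes [measurable]: "u \<in> borel_measurable M" "v \<in> borel_measurable M"
    and nonneg: "AE x in M. 0 \<le> u x" "AE x in M. 0 \<le> v x"
    and exps: "0 \<le> \<alpha>" "0 \<le> \<beta>" "\<alpha> + \<beta> = 1" and AC: "0 \<le> A" "0 \<le> C"
    and u: "(\<integral>\<^sup>+x. ennreal (u x) \<partial>M) \<le> ennreal A" and v: "(\<integral>\<^sup>+x. ennreal (v x) \<partial>M) \<le> ennreal C"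
  shows "(\<integral>\<^sup>+x. ennreal (u x powr \<alpha> * v x powr \<beta>) \<partial>M) \<le> ennreal (A powr \<alpha> * C powr \<beta>)"
proof -
  \<comment> \<open>If \<open>A\<close> or \<open>C\<close> is zero, the corresponding function
    vanishes almost everywhere. As \<open>0 powr a = 0\<close> even for \<open>a = 0\<close>, the
    integrand then vanishes almost everywhere too.\<close>
  consider "A = 0" | "C = 0" | "0 < A" "0 < C" using AC by linarith
  then show ?thesis
  proof cases
    case 1
    then have "AE x in M. ennreal (u x) = 0"
      using u by (subst nn_integral_0_iff_AE[symmetric]) auto
    then have "AE x in M. ennreal (u x powr \<alpha> * v x powr \<beta>) = 0"
      using nonneg(1) by eventually_elim (simp add: ennreal_eq_0_iff)
    then show ?thesis by (subst nn_integral_0_iff_AE[THEN iffD2]) auto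
  next
    case 2
    then have "AE x in M. ennreal (v x) = 0"
      using v by (subst nn_integral_0_iff_AE[symmetric]) auto
    then have "AE x in M. ennreal (u x powr \<alpha> * v x powr \<beta>) = 0"
      using nonneg(2) by eventually_elim (simp add: ennreal_eq_0_iff)
    then show ?thesis by (subst nn_integral_0_iff_AE[THEN iffD2]) auto
  next
    case 3
    define c where "c = A powr \<alpha> * C powr \<beta> * (\<alpha> / A)"
    define d where "d = A powr \<alpha> * C powr \<beta> * (\<beta> / C)"
    have cd: "0 \<le> c" "0 \<le> d" using 3 exps by (auto simp: c_def d_def)
    have young: "a powr \<alpha> * b powr \<beta> \<le> c * a + d * b" if ab: "0 \<le> a" "0 \<le> b" for a b
    proof (cases "a = 0 \<or> b = 0")
      case True
      then show ?thesis using cd ab by auto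
    next
      case False
      then have "(a / A) powr \<alpha> * (b / C) powr \<beta> \<le> \<alpha> * (a / A) + \<beta> * (b / C)"
        using exps ab 3 by (intro Youngs_inequality_0) auto
      then have "A powr \<alpha> * C powr \<beta> * ((a / A) powr \<alpha> * (b / C) powr \<beta>)
        \<le> A powr \<alpha> * C powr \<beta> * (\<alpha> * (a / A) + \<beta> * (b / C))"
        by (intro mult_left_mono) auto
      moreover have "A powr \<alpha> * C powr \<beta> * ((a / A) powr \<alpha> * (b / C) powr \<beta>) = a powr \<alpha> * b powr \<beta>"
        using ab 3 by (simp add: powr_divide)
      ultimately show ?thesis by (simp add: c_def d_def algebra_simps)
    qed
    have "(\<integral>\<^sup>+x. ennreal (u x powr \<alpha> * v x powr \<beta>) \<partial>M) \<le> (\<integral>\<^sup>+x. ennreal c * ennreal (u x) + ennreal d * ennreal (v x) \<partial>M)"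
    proof (rule nn_integral_mono_AE)
      show "AE x in M. ennreal (u x powr \<alpha> * v x powr \<beta>) \<le> ennreal c * ennreal (u x) + ennreal d * ennreal (v x)"
        using nonneg by eventually_elim (use young cd in \<open>simp flip: ennreal_mult ennreal_plus\<close>)
    qed
    also have "\<dots> = ennreal c * (\<integral>\<^sup>+x. ennreal (u x) \<partial>M) + ennreal d * (\<integral>\<^sup>+x. ennreal (v x) \<partial>M)"
      by (simp add: nn_integral_add nn_integral_cmult)
    also have "\<dots> \<le> ennreal c * ennreal A + ennreal d * ennreal C"
      using u v by (intro add_mono mult_left_mono) auto
    also have "\<dots> = ennreal (c * A + d * C)"
      using cd AC by (simp flip: ennreal_mult ennreal_plus)
    also have "c * A + d * C = A powr \<alpha> * C powr \<beta>"
    proof -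
      have "c * A + d * C = A powr \<alpha> * C powr \<beta> * (\<alpha> + \<beta>)"
        using 3 by (simp add: c_def d_def algebra_simps)
      then show ?thesis using exps by simp
    qed
    finally show ?thesis .
  qed
qed

lemma nn_integral_powr_le_Jensen:
  fixes u :: "'a \<Rightarrow> real"
  assumes "emeasure M (space M) = 1" "u \<in> borel_measurable M" "AE x in M. 0 \<le> u x"
    and "0 \<le> \<alpha>" "\<alpha> \<le> 1" "0 \<le> A" "(\<integral>\<^sup>+x. ennreal (u x) \<partial>M) \<le> ennreal A"
  shows "(\<integral>\<^sup>+x. ennreal (u x powr \<alpha>) \<partial>M) \<le> ennreal (A powr \<alpha>)"
  using nn_integral_Hoelder[of u M "\<lambda>x. 1" \<alpha> "1 - \<alpha>" A 1] assms by simp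

section \<open>Muckenhoupt weights perturbed by exponentials\<close>

text \<open>Turns averages over \<open>B\<close> into integrals against a probability measure, where
  Hoelder and Jensen need no normalizing factors.\<close>

lemma nn_avg_eq_uniform_measure:
  assumes "g \<in> borel_measurable M" "B \<in> sets M"
  shows "nn_avg M B g = (\<integral>\<^sup>+x. g x \<partial>uniform_measure M B)"
  by (simp add: nn_avg_def nn_integral_uniform_measure assms)

lemma epowr_ennreal_pos: "0 < x \<Longrightarrow> epowr (ennreal x) a = ennreal (x powr a)"
  by (simp add: epowr_def ennreal_eq_0_iff)

lemma epowr_ennreal_nonneg: "0 \<le> x \<Longrightarrow> 0 < a \<Longrightarrow> epowr (ennreal x) a = ennreal (x powr a)"
  by (cases "x = 0") (simp_all add: epowr_def ennreal_eq_0_iff)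

lemma epowr_ennreal_neg: "a < 0 \<Longrightarrow> epowr (ennreal x) a = (if x \<le> 0 then \<infinity> else ennreal (x powr a))"
  by (auto simp: epowr_def ennreal_eq_0_iff)

lemma epowr_mono: "0 < a \<Longrightarrow> x \<le> y \<Longrightarrow> epowr x a \<le> epowr y a"
  unfolding epowr_def
  by (cases x; cases y) (auto simp: top_unique intro!: ennreal_leI powr_mono2)

lemma one_minus_conjugate_exponent: "1 < s \<Longrightarrow> 1 - conjugate_exponent s = - (1 / (s - 1))"
  by (simp add: conjugate_exponent_def field_simps)

lemma measurable_epowr_neg:
  assumes [measurable]: "u \<in> borel_measurable M" and "a < 0"
  shows "(\<lambda>x. epowr (ennreal (u x)) a) \<in> borel_measurable M"
  unfolding epowr_ennreal_neg[OF assms(2)] by measurable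

lemma uniform_measure_basis:
  assumes "is_basis M \<B>" "B \<in> \<B>"
  shows "B \<in> sets M" "emeasure (uniform_measure M B) (space (uniform_measure M B)) = 1"
proof -
  have *: "0 < emeasure M B" "emeasure M B < \<infinity>" and B: "B \<in> sets M"
    using assms by (auto simp: is_basis_def)
  show "B \<in> sets M" by fact
  show "emeasure (uniform_measure M B) (space (uniform_measure M B)) = 1"
    using * B sets.sets_into_space[OF B]
    by (simp add: emeasure_uniform_measure Int_absorb2 zero_less_iff_neq_zero less_top ennreal_divide_self)
qed

lemma weightD_avg:
  assumes "is_basis M \<B>" "weight M \<B> u" "B \<in> \<B>"
  shows "(\<integral>\<^sup>+x. ennreal (u x) \<partial>uniform_measure M B) < \<infinity>"
proof -
  have "0 < emeasure M B" "B \<in> sets M" using assms by (auto simp: is_basis_def)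
  then show ?thesis
    using assms(2,3)
    by (auto simp: weight_def nn_integral_uniform_measure ennreal_divide_eq_top_iff less_top[symmetric])
qed

text \<open>A finite constant makes the average of the negative power finite. As
  \<open>epowr\<close> is infinite there when \<open>u\<close> is zero, this forces
  \<open>u > 0\<close> almost everywhere on \<open>B\<close>, where \<open>epowr\<close> agrees with
  the real \<open>powr\<close>.\<close>

lemma MuckenhouptD:
  assumes basis: "is_basis M \<B>" and s: "1 < s" and u: "u \<in> Muckenhoupt M \<B> s" and B: "B \<in> \<B>"
  obtains A C where "0 \<le> A" "0 \<le> C"
    "(\<integral>\<^sup>+x. ennreal (u x) \<partial>uniform_measure M B) = ennreal A"
    "(\<integral>\<^sup>+x. ennreal (u x powr (- (1 / (s - 1)))) \<partial>uniform_measure M B) = ennreal C"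
    "AE x in uniform_measure M B. 0 < u x"
    "A * C powr (s - 1) \<le> enn2real (Muckenhoupt_const M \<B> s u)"
proof -
  let ?N = "uniform_measure M B" and ?a = "- (1 / (s - 1))"
  have neg: "?a < 0" using s by simp
  have wt: "weight M \<B> u" and fin: "Muckenhoupt_const M \<B> s u < \<infinity>"
    using u by (auto simp: Muckenhoupt_def)
  then have [measurable]: "u \<in> borel_measurable M" by (simp add: weight_def)
  note BM = uniform_measure_basis(1)[OF basis B]
  have \<sigma>_eq: "nn_avg M B (\<lambda>x. epowr (ennreal (u x)) ?a) = (\<integral>\<^sup>+x. epowr (ennreal (u x)) ?a \<partial>?N)"
    by (intro nn_avg_eq_uniform_measure measurable_epowr_neg neg BM) simp
  define \<sigma> where "\<sigma> = (\<integral>\<^sup>+x. epowr (ennreal (u x)) ?a \<partial>?N)"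
  have X_eq: "nn_avg M B (\<lambda>x. ennreal (u x)) = (\<integral>\<^sup>+x. ennreal (u x) \<partial>?N)"
    by (intro nn_avg_eq_uniform_measure BM) simp
  have le: "(if \<sigma> = \<infinity> then \<infinity> else (\<integral>\<^sup>+x. ennreal (u x) \<partial>?N) * epowr \<sigma> (s - 1)) \<le> Muckenhoupt_const M \<B> s u"
    unfolding Muckenhoupt_const_def one_minus_conjugate_exponent[OF s]
    by (rule SUP_upper2[OF B]) (simp add: \<sigma>_eq X_eq \<sigma>_def Let_def)
  then have "\<sigma> \<noteq> \<infinity>" using fin by auto
  then obtain C where C: "0 \<le> C" "\<sigma> = ennreal C" by (cases \<sigma>) auto
  obtain A where A: "0 \<le> A" "(\<integral>\<^sup>+x. ennreal (u x) \<partial>?N) = ennreal A"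
    using weightD_avg[OF basis wt B] by (cases "\<integral>\<^sup>+x. ennreal (u x) \<partial>?N") auto
  have "AE x in ?N. epowr (ennreal (u x)) ?a \<noteq> \<infinity>"
    using \<open>\<sigma> \<noteq> \<infinity>\<close> measurable_epowr_neg[OF _ neg, of u ?N]
    by (intro nn_integral_PInf_AE) (auto simp: \<sigma>_def)
  then have pos: "AE x in ?N. 0 < u x"
    by eventually_elim (use neg in \<open>auto simp: epowr_ennreal_neg split: if_splits\<close>)
  have "ennreal (A * C powr (s - 1)) \<le> Muckenhoupt_const M \<B> s u"
    using le s A C by (simp add: epowr_ennreal_nonneg ennreal_mult)
  then have "A * C powr (s - 1) \<le> enn2real (Muckenhoupt_const M \<B> s u)"
    using fin A C by (cases "Muckenhoupt_const M \<B> s u") auto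
  moreover have "(\<integral>\<^sup>+x. ennreal (u x powr ?a) \<partial>?N) = ennreal C"
    unfolding C(2)[symmetric] \<sigma>_def using pos
    by (intro nn_integral_cong_AE, eventually_elim) (simp add: epowr_ennreal_pos)
  ultimately show thesis using that A C pos by blast
qed

text \<open>Converse to \<open>MuckenhouptD\<close>, with one bound \<open>\<kappa>\<close> for the
  whole basis. Positivity is part of \<open>avgs\<close> because the real \<open>powr\<close> is
  zero at zero and would not detect a zero set of \<open>u\<close>; the bound \<open>A\<close> also
  yields local integrability.\<close>

lemma MuckenhouptI:
  assumes basis: "is_basis M \<B>" and s: "1 < s" and meas [measurable]: "u \<in> borel_measurable M"
    and nonneg: "\<And>x. x \<in> space M \<Longrightarrow> 0 \<le> u x"
    and avgs: "\<And>B. B \<in> \<B> \<Longrightarrow> \<exists>A C. 0 \<le> A \<and> 0 \<le> C \<and>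
      (\<integral>\<^sup>+x. ennreal (u x) \<partial>uniform_measure M B) \<le> ennreal A \<and>
      (\<integral>\<^sup>+x. ennreal (u x powr (- (1 / (s - 1)))) \<partial>uniform_measure M B) \<le> ennreal C \<and>
      (AE x in uniform_measure M B. 0 < u x) \<and> A * C powr (s - 1) \<le> \<kappa>"
  shows "u \<in> Muckenhoupt M \<B> s" "Muckenhoupt_const M \<B> s u \<le> ennreal \<kappa>"
proof -
  let ?a = "- (1 / (s - 1))"
  have neg: "?a < 0" using s by simp
  show le: "Muckenhoupt_const M \<B> s u \<le> ennreal \<kappa>"
    unfolding Muckenhoupt_const_def one_minus_conjugate_exponent[OF s]
  proof (rule SUP_least)
    fix B assume B: "B \<in> \<B>"
    let ?N = "uniform_measure M B"
    note BM = uniform_measure_basis(1)[OF basis B]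
    obtain A C where AC: "0 \<le> A" "0 \<le> C" "(\<integral>\<^sup>+x. ennreal (u x) \<partial>?N) \<le> ennreal A"
      "(\<integral>\<^sup>+x. ennreal (u x powr ?a) \<partial>?N) \<le> ennreal C"
      "AE x in ?N. 0 < u x" "A * C powr (s - 1) \<le> \<kappa>"
      using avgs[OF B] by blast
    have "nn_avg M B (\<lambda>x. epowr (ennreal (u x)) ?a) = (\<integral>\<^sup>+x. epowr (ennreal (u x)) ?a \<partial>?N)"
      by (intro nn_avg_eq_uniform_measure measurable_epowr_neg neg BM) simp
    also have "\<dots> = (\<integral>\<^sup>+x. ennreal (u x powr ?a) \<partial>?N)"
      using AC(5) by (intro nn_integral_cong_AE, eventually_elim) (simp add: epowr_ennreal_pos)
    finally have \<sigma>: "nn_avg M B (\<lambda>x. epowr (ennreal (u x)) ?a) \<le> ennreal C" using AC by simp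
    have X: "nn_avg M B (\<lambda>x. ennreal (u x)) \<le> ennreal A"
      using AC by (subst nn_avg_eq_uniform_measure[OF _ BM]) auto
    have "epowr (nn_avg M B (\<lambda>x. epowr (ennreal (u x)) ?a)) (s - 1) \<le> ennreal (C powr (s - 1))"
      using epowr_mono[OF _ \<sigma>, of "s - 1"] s AC by (simp add: epowr_ennreal_nonneg)
    then have "nn_avg M B (\<lambda>x. ennreal (u x)) * epowr (nn_avg M B (\<lambda>x. epowr (ennreal (u x)) ?a)) (s - 1)
      \<le> ennreal (A * C powr (s - 1))"
      using X AC by (simp add: ennreal_mult mult_mono)
    also have "\<dots> \<le> ennreal \<kappa>" using AC by (intro ennreal_leI) auto
    finally show "(let \<sigma> = nn_avg M B (\<lambda>x. epowr (ennreal (u x)) ?a)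
      in if \<sigma> = \<infinity> then \<infinity> else nn_avg M B (\<lambda>x. ennreal (u x)) * epowr \<sigma> (s - 1)) \<le> ennreal \<kappa>"
      using \<sigma> by (auto simp: Let_def top_unique)
  qed
  have "(\<integral>\<^sup>+x\<in>B. ennreal (u x) \<partial>M) < \<infinity>" if B: "B \<in> \<B>" for B
  proof -
    have BM: "B \<in> sets M" "emeasure M B < \<infinity>" using basis B by (auto simp: is_basis_def)
    obtain A where "(\<integral>\<^sup>+x. ennreal (u x) \<partial>uniform_measure M B) \<le> ennreal A"
      using avgs[OF B] by blast
    then have "(\<integral>\<^sup>+x\<in>B. ennreal (u x) \<partial>M) / emeasure M B < \<infinity>"
      using BM by (subst (asm) nn_integral_uniform_measure) (auto simp: le_less_trans[OF _ ennreal_less_top])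
    then show ?thesis
      using BM by (auto simp: ennreal_divide_eq_top_iff less_top[symmetric] ennreal_top_divide split: if_splits)
  qed
  then have "weight M \<B> u" using nonneg meas by (simp add: weight_def)
  then show "u \<in> Muckenhoupt M \<B> s"
    using le by (auto simp: Muckenhoupt_def intro: le_less_trans)
qed

text \<open>Hoelder's inequality for \<open>1\<close>, written as \<open>u powr (1 / s)\<close>
  times the power \<open>1 - 1 / s\<close> of the dual weight. It puts the argument of
  \<open>\<phi>\<close> in the range where \<open>\<phi>\<close> is monotone; over an empty basis
  the constant is \<open>0\<close>.\<close>

lemma Muckenhoupt_const_ge_1:
  assumes basis: "is_basis M \<B>" and s: "1 < s" and u: "u \<in> Muckenhoupt M \<B> s" and "\<B> \<noteq> {}"
  shows "1 \<le> enn2real (Muckenhoupt_const M \<B> s u)"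
proof -
  obtain B where B: "B \<in> \<B>" using assms by blast
  let ?N = "uniform_measure M B" and ?a = "- (1 / (s - 1))"
  obtain A C where AC: "0 \<le> A" "0 \<le> C"
    "(\<integral>\<^sup>+x. ennreal (u x) \<partial>?N) = ennreal A"
    "(\<integral>\<^sup>+x. ennreal (u x powr ?a) \<partial>?N) = ennreal C"
    "AE x in ?N. 0 < u x"
    "A * C powr (s - 1) \<le> enn2real (Muckenhoupt_const M \<B> s u)"
    using MuckenhouptD[OF basis s u B] by blast
  have [measurable]: "u \<in> borel_measurable M" using u by (simp add: Muckenhoupt_def weight_def)
  have "1 = (\<integral>\<^sup>+x. ennreal 1 \<partial>?N)"
    using uniform_measure_basis(2)[OF basis B] by simp
  also have "\<dots> = (\<integral>\<^sup>+x. ennreal (u x powr (1 / s) * (u x powr ?a) powr (1 - 1 / s)) \<partial>?N)"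
  proof (rule nn_integral_cong_AE)
    have *: "1 / s + ?a * (1 - 1 / s) = 0" using s by (simp add: field_simps)
    show "AE x in ?N. ennreal 1 = ennreal (u x powr (1 / s) * (u x powr ?a) powr (1 - 1 / s))"
      using AC(5) by eventually_elim (simp only: powr_powr powr_add[symmetric] *, simp)
  qed
  also have "\<dots> \<le> ennreal (A powr (1 / s) * C powr (1 - 1 / s))"
  proof (rule nn_integral_Hoelder)
    show "AE x in ?N. 0 \<le> u x" using AC(5) by eventually_elim simp
  qed (use AC s in auto)
  finally have "1 powr s \<le> (A powr (1 / s) * C powr (1 - 1 / s)) powr s"
    using s by (intro powr_mono2) (auto simp flip: ennreal_1)
  also have "\<dots> = A * C powr (s - 1)"
    using s AC by (simp add: powr_mult powr_powr left_diff_distrib)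
  finally show ?thesis using AC by simp
qed

text \<open>With \<open>c\<close> from \<open>osc\<close>, the new weight factors into the power
  \<open>1 / \<eta>\<close> of \<open>w powr (\<theta> * \<eta>)\<close>, the power
  \<open>1 / \<eta>'\<close> of \<open>exp (- \<theta> * \<eta>' * (h - c))\<close>, and the number
  \<open>exp (- \<theta> * c)\<close>. Hoelder separates the first two; the dual weight is treated
  alike, and the factors with \<open>c\<close> cancel in the product of the averages.\<close>

lemma Muckenhoupt_times_exp:
  assumes basis: "is_basis M \<B>" and s: "1 < s" and \<theta>: "0 < \<theta>" and \<eta>: "1 < \<eta>" "1 / \<eta> + 1 / \<eta>' = 1"
    and w [measurable]: "w \<in> borel_measurable M" and w_nonneg: "\<And>x. x \<in> space M \<Longrightarrow> 0 \<le> w x"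
    and W: "(\<lambda>x. w x powr (\<theta> * \<eta>)) \<in> Muckenhoupt M \<B> s"
    and h [measurable]: "h \<in> borel_measurable M"
    and osc: "\<And>B. B \<in> \<B> \<Longrightarrow> \<exists>c. nn_avg M B (\<lambda>x. ennreal (exp (\<theta> * \<eta>' * \<bar>h x - c\<bar> / min 1 (s - 1)))) \<le> 2"
  defines "\<kappa> \<equiv> 4 powr (min 1 (s - 1) / \<eta>') *
      enn2real (Muckenhoupt_const M \<B> s (\<lambda>x. w x powr (\<theta> * \<eta>))) powr (1 / \<eta>)"
  shows "(\<lambda>x. (w x * exp (- h x)) powr \<theta>) \<in> Muckenhoupt M \<B> s"
    and "Muckenhoupt_const M \<B> s (\<lambda>x. (w x * exp (- h x)) powr \<theta>) \<le> ennreal \<kappa>"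
proof -
  \<comment> \<open>The largest number with \<open>m \<le> 1\<close> and
    \<open>m * a \<le> 1\<close>, where \<open>- a\<close> is the exponent of the dual weight: this
    is what Jensen's inequality requires for the two averages.\<close>
  define m where "m = min 1 (s - 1)"
  define a where "a = 1 / (s - 1)"
  have m: "0 < m" "m \<le> 1" "m * a \<le> 1" and a: "0 < a" "a * (s - 1) = 1" "(s - 1) * a = 1"
    using s by (auto simp: m_def a_def min_def field_simps)
  have \<eta>': "1 < \<eta>'" "1 / \<eta>' = 1 - 1 / \<eta>"
  proof -
    show "1 / \<eta>' = 1 - 1 / \<eta>" using \<eta> by simp
    then have "0 < 1 / \<eta>'" "1 / \<eta>' < 1" using \<eta>(1) by auto
    then show "1 < \<eta>'" by (auto simp: field_simps split: if_splits)
  qed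
  have "\<exists>X Y. 0 \<le> X \<and> 0 \<le> Y \<and>
      (\<integral>\<^sup>+x. ennreal ((w x * exp (- h x)) powr \<theta>) \<partial>uniform_measure M B) \<le> ennreal X \<and>
      (\<integral>\<^sup>+x. ennreal (((w x * exp (- h x)) powr \<theta>) powr - (1 / (s - 1))) \<partial>uniform_measure M B) \<le> ennreal Y \<and>
      (AE x in uniform_measure M B. 0 < (w x * exp (- h x)) powr \<theta>) \<and> X * Y powr (s - 1) \<le> \<kappa>"
    if B: "B \<in> \<B>" for B
  proof -
    let ?N = "uniform_measure M B"
    let ?W = "\<lambda>x. w x powr (\<theta> * \<eta>)"
    obtain A C where AC: "0 \<le> A" "0 \<le> C"
      "(\<integral>\<^sup>+x. ennreal (?W x) \<partial>?N) = ennreal A"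
      "(\<integral>\<^sup>+x. ennreal (?W x powr - a) \<partial>?N) = ennreal C"
      "AE x in ?N. 0 < ?W x"
      "A * C powr (s - 1) \<le> enn2real (Muckenhoupt_const M \<B> s ?W)"
      using MuckenhouptD[OF basis s W B] unfolding a_def by blast
    have w_pos: "AE x in ?N. 0 < w x"
      using AC(5) AE_space by eventually_elim (use w_nonneg in \<open>force simp: less_le\<close>)
    obtain c where "nn_avg M B (\<lambda>x. ennreal (exp (\<theta> * \<eta>' * \<bar>h x - c\<bar> / m))) \<le> 2"
      using osc[OF B] unfolding m_def by blast
    then have osc2: "(\<integral>\<^sup>+x. ennreal (exp (\<theta> * \<eta>' * \<bar>h x - c\<bar> / m)) \<partial>?N) \<le> ennreal 2"
      using uniform_measure_basis(1)[OF basis B] by (subst (asm) nn_avg_eq_uniform_measure) auto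
    \<comment> \<open>The exponential is at most the power \<open>m * \<bar>d\<bar>\<close> of the
      one in \<open>osc2\<close>, and Jensen's inequality applies to that power. Used with
      \<open>d = - 1\<close> for the weight and \<open>d = a\<close> for its dual.\<close>
    have exp_le: "(\<integral>\<^sup>+x. ennreal (exp (d * \<theta> * \<eta>' * (h x - c))) \<partial>?N) \<le> ennreal (2 powr (m * \<bar>d\<bar>))"
      if "m * \<bar>d\<bar> \<le> 1" for d
    proof -
      have "(\<integral>\<^sup>+x. ennreal (exp (d * \<theta> * \<eta>' * (h x - c))) \<partial>?N)
        \<le> (\<integral>\<^sup>+x. ennreal (exp (\<theta> * \<eta>' * \<bar>h x - c\<bar> / m) powr (m * \<bar>d\<bar>)) \<partial>?N)"
      proof (intro nn_integral_mono ennreal_leI)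
        fix x
        have "d * \<theta> * \<eta>' * (h x - c) \<le> \<bar>d * \<theta> * \<eta>' * (h x - c)\<bar>" by simp
        also have "\<dots> = (m * \<bar>d\<bar>) * (\<theta> * \<eta>' * \<bar>h x - c\<bar> / m)"
          using \<theta> \<eta>' m by (simp add: abs_mult)
        finally show "exp (d * \<theta> * \<eta>' * (h x - c)) \<le> exp (\<theta> * \<eta>' * \<bar>h x - c\<bar> / m) powr (m * \<bar>d\<bar>)"
          by (simp add: powr_def)
      qed
      also have "\<dots> \<le> ennreal (2 powr (m * \<bar>d\<bar>))"
        using osc2 m that uniform_measure_basis(2)[OF basis B]
        by (intro nn_integral_powr_le_Jensen) auto
      finally show ?thesis .
    qed
    define X where "X = exp (- \<theta> * c) * (A powr (1 / \<eta>) * (2 powr m) powr (1 / \<eta>'))"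
    define Y where "Y = exp (a * \<theta> * c) * (C powr (1 / \<eta>) * (2 powr (m * a)) powr (1 / \<eta>'))"
    have X: "(\<integral>\<^sup>+x. ennreal ((w x * exp (- h x)) powr \<theta>) \<partial>?N) \<le> ennreal X"
    proof -
      have "(\<integral>\<^sup>+x. ennreal ((w x * exp (- h x)) powr \<theta>) \<partial>?N)
        = (\<integral>\<^sup>+x. ennreal (exp (- \<theta> * c)) * ennreal (?W x powr (1 / \<eta>) * exp (- 1 * \<theta> * \<eta>' * (h x - c)) powr (1 / \<eta>')) \<partial>?N)"
      proof (rule nn_integral_cong_AE)
        show "AE x in ?N. ennreal ((w x * exp (- h x)) powr \<theta>)
          = ennreal (exp (- \<theta> * c)) * ennreal (?W x powr (1 / \<eta>) * exp (- 1 * \<theta> * \<eta>' * (h x - c)) powr (1 / \<eta>'))"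
          using w_pos
        proof eventually_elim
          case (elim x)
          have "exp (- \<theta> * c) * exp (- 1 * \<theta> * \<eta>' * (h x - c)) powr (1 / \<eta>') = exp (- h x) powr \<theta>"
            using \<eta>' by (simp add: powr_def mult_exp_exp algebra_simps)
          then show ?case
            using elim \<eta> by (simp add: powr_mult powr_powr mult_ac flip: ennreal_mult)
        qed
      qed
      also have "\<dots> = ennreal (exp (- \<theta> * c)) * (\<integral>\<^sup>+x. ennreal (?W x powr (1 / \<eta>) * exp (- 1 * \<theta> * \<eta>' * (h x - c)) powr (1 / \<eta>')) \<partial>?N)"
        by (intro nn_integral_cmult) simp
      also have "\<dots> \<le> ennreal (exp (- \<theta> * c)) * ennreal (A powr (1 / \<eta>) * (2 powr m) powr (1 / \<eta>'))"
        using AC \<eta> \<eta>' exp_le[of "- 1"] m by (intro mult_left_mono nn_integral_Hoelder) auto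
      finally show ?thesis by (simp add: X_def ennreal_mult)
    qed
    have Y: "(\<integral>\<^sup>+x. ennreal (((w x * exp (- h x)) powr \<theta>) powr - a) \<partial>?N) \<le> ennreal Y"
    proof -
      have "(\<integral>\<^sup>+x. ennreal (((w x * exp (- h x)) powr \<theta>) powr - a) \<partial>?N)
        = (\<integral>\<^sup>+x. ennreal (exp (a * \<theta> * c)) * ennreal ((?W x powr - a) powr (1 / \<eta>) * exp (a * \<theta> * \<eta>' * (h x - c)) powr (1 / \<eta>')) \<partial>?N)"
      proof (rule nn_integral_cong_AE)
        show "AE x in ?N. ennreal (((w x * exp (- h x)) powr \<theta>) powr - a)
          = ennreal (exp (a * \<theta> * c)) * ennreal ((?W x powr - a) powr (1 / \<eta>) * exp (a * \<theta> * \<eta>' * (h x - c)) powr (1 / \<eta>'))"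
          using w_pos
        proof eventually_elim
          case (elim x)
          have "exp (a * \<theta> * c) * exp (a * \<theta> * \<eta>' * (h x - c)) powr (1 / \<eta>') = (exp (- h x) powr \<theta>) powr - a"
            using \<eta>' by (simp add: powr_def mult_exp_exp algebra_simps)
          moreover have "(?W x powr - a) powr (1 / \<eta>) = (w x powr \<theta>) powr - a"
            using \<eta> by (simp add: powr_powr)
          ultimately show ?case
            using elim \<eta> by (simp add: powr_mult mult_ac flip: ennreal_mult)
        qed
      qed
      also have "\<dots> = ennreal (exp (a * \<theta> * c)) * (\<integral>\<^sup>+x. ennreal ((?W x powr - a) powr (1 / \<eta>) * exp (a * \<theta> * \<eta>' * (h x - c)) powr (1 / \<eta>')) \<partial>?N)"
        by (intro nn_integral_cmult) simp
      also have "\<dots> \<le> ennreal (exp (a * \<theta> * c)) * ennreal (C powr (1 / \<eta>) * (2 powr (m * a)) powr (1 / \<eta>'))"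
        using AC \<eta> \<eta>' exp_le[of a] m a by (intro mult_left_mono nn_integral_Hoelder) auto
      finally show ?thesis by (simp add: Y_def ennreal_mult)
    qed
    have "X * Y powr (s - 1) = (A * C powr (s - 1)) powr (1 / \<eta>) * ((2 powr m) * (2 powr (m * a)) powr (s - 1)) powr (1 / \<eta>')"
    proof -
      have "exp (a * \<theta> * c) powr (s - 1) = exp (\<theta> * c)"
        using a by (simp add: powr_def mult.assoc[symmetric])
      moreover have "exp (- \<theta> * c) * exp (\<theta> * c) = 1" by (simp add: mult_exp_exp)
      ultimately have "X * Y powr (s - 1) = (A powr (1 / \<eta>) * (C powr (1 / \<eta>)) powr (s - 1)) * ((2 powr m) powr (1 / \<eta>') * ((2 powr (m * a)) powr (1 / \<eta>')) powr (s - 1))"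
        using AC by (simp add: X_def Y_def powr_mult mult_ac)
      also have "\<dots> = (A * C powr (s - 1)) powr (1 / \<eta>) * ((2 powr m) * (2 powr (m * a)) powr (s - 1)) powr (1 / \<eta>')"
        using AC by (simp add: powr_mult powr_powr mult_ac)
      finally show ?thesis .
    qed
    \<comment> \<open>Both factors equal \<open>2 powr m\<close> since
      \<open>a * (s - 1) = 1\<close>; this is the source of the 4 in
      \<open>\<kappa>\<close>.\<close>
    also have "(2 powr m) * (2 powr (m * a)) powr (s - 1) = 4 powr m"
      using a by (simp add: powr_powr mult.assoc flip: powr_mult)
    also have "(A * C powr (s - 1)) powr (1 / \<eta>) * (4 powr m) powr (1 / \<eta>') \<le> \<kappa>"
    proof -
      have "(A * C powr (s - 1)) powr (1 / \<eta>) \<le> enn2real (Muckenhoupt_const M \<B> s ?W) powr (1 / \<eta>)"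
        using AC \<eta> by (intro powr_mono2) auto
      then show ?thesis
        by (simp add: \<kappa>_def m_def powr_powr mult.commute mult_left_mono)
    qed
    finally have "X * Y powr (s - 1) \<le> \<kappa>" .
    moreover have "0 \<le> X" "0 \<le> Y" by (simp_all add: X_def Y_def)
    moreover have "AE x in ?N. 0 < (w x * exp (- h x)) powr \<theta>"
      using w_pos by eventually_elim simp
    ultimately show ?thesis using X Y unfolding a_def by blast
  qed
  from MuckenhouptI[OF basis s _ _ this] show
    "(\<lambda>x. (w x * exp (- h x)) powr \<theta>) \<in> Muckenhoupt M \<B> s"
    "Muckenhoupt_const M \<B> s (\<lambda>x. (w x * exp (- h x)) powr \<theta>) \<le> ennreal \<kappa>"
    by simp_all
qed

section \<open>The exponential and its Taylor polynomials\<close>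

text \<open>The remainder involves only indices above \<open>n\<close>, where
  \<open>(l * u) ^ i \<le> l ^ n * u ^ i\<close>. Decay in \<open>n\<close> is bought by the larger
  argument \<open>u\<close> in the exponential.\<close>

lemma exp_minus_Taylor_le:
  fixes \<zeta> :: complex
  assumes "norm \<zeta> \<le> l * u" "0 \<le> l" "l \<le> 1" "0 \<le> u"
  shows "norm (exp \<zeta> - (\<Sum>m\<le>n. \<zeta> ^ m / fact m)) \<le> l ^ n * exp u"
proof -
  have "(\<lambda>m. \<zeta> ^ m / fact m) sums exp \<zeta>"
    using exp_converges[of \<zeta>] by (simp add: scaleR_conv_of_real field_simps)
  then have F: "(\<lambda>m. \<zeta> ^ (m + Suc n) / fact (m + Suc n)) sums (exp \<zeta> - (\<Sum>m\<le>n. \<zeta> ^ m / fact m))"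
    by (subst sums_iff_shift) (simp add: lessThan_Suc_atMost)
  have "(\<lambda>m. u ^ m / fact m) sums exp u"
    using exp_converges[of u] by (simp add: field_simps)
  then have "(\<lambda>m. u ^ (m + Suc n) / fact (m + Suc n)) sums (exp u - (\<Sum>m\<le>n. u ^ m / fact m))"
    by (subst sums_iff_shift) (simp add: lessThan_Suc_atMost)
  then have G: "(\<lambda>m. l ^ n * (u ^ (m + Suc n) / fact (m + Suc n))) sums (l ^ n * (exp u - (\<Sum>m\<le>n. u ^ m / fact m)))"
    by (rule sums_mult)
  have "norm (\<zeta> ^ i / fact i) \<le> l ^ n * (u ^ i / fact i)" if "n \<le> i" for i
  proof -
    have "norm \<zeta> ^ i \<le> (l * u) ^ i" by (intro power_mono assms) simp
    also have "\<dots> \<le> l ^ n * u ^ i"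
      unfolding power_mult_distrib using assms that by (intro mult_right_mono power_decreasing) auto
    finally show ?thesis by (simp add: norm_divide norm_power divide_right_mono)
  qed
  then have "norm (exp \<zeta> - (\<Sum>m\<le>n. \<zeta> ^ m / fact m)) \<le> l ^ n * (exp u - (\<Sum>m\<le>n. u ^ m / fact m))"
    by (intro norm_sums_le[OF F G]) (simp only: le_add2 le_SucI add_Suc_right)
  also have "\<dots> \<le> l ^ n * exp u"
    using assms by (intro mult_left_mono) (auto intro: sum_nonneg)
  finally show ?thesis .
qed

text \<open>One term of a series with nonnegative terms. It places \<open>b ^ m f\<close> under the
  growth that the weight \<open>w exp (- \<rho> \<bar>b\<bar>)\<close> absorbs.\<close>

lemma power_le_fact_times_exp:
  fixes u :: real
  assumes "0 \<le> u"
  shows "u ^ m \<le> fact m * exp u"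
proof -
  have "(\<lambda>i. u ^ i / fact i) sums exp u"
    using exp_converges[of u] by (simp add: field_simps)
  then have "(\<Sum>i\<in>{m}. u ^ i / fact i) \<le> exp u"
    using sum_le_suminf[of "\<lambda>i. u ^ i / fact i" "{m}"] assms by (auto simp: sums_iff)
  then show ?thesis by (simp add: field_simps)
qed

definition clip :: "real \<Rightarrow> complex \<Rightarrow> complex" where
  "clip K = closest_point (cball 0 K)"

lemma clip_lipschitz: "0 \<le> K \<Longrightarrow> norm (clip K x - clip K y) \<le> norm (x - y)"
  using closest_point_lipschitz[of "cball 0 K" x y] by (simp add: clip_def dist_norm)

lemma clip_id: "norm x \<le> K \<Longrightarrow> clip K x = x"
  by (simp add: clip_def closest_point_self)

lemma norm_clip_le_self: "0 \<le> K \<Longrightarrow> norm (clip K x) \<le> norm x"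
  using clip_lipschitz[of K x 0] by (simp add: clip_id)

lemma norm_clip_le: "0 \<le> K \<Longrightarrow> norm (clip K x) \<le> K"
  using closest_point_in_set[of "cball 0 K" x] by (simp add: clip_def)

lemma borel_measurable_clip [measurable]:
  "0 \<le> K \<Longrightarrow> f \<in> borel_measurable M \<Longrightarrow> (\<lambda>x. clip K (f x)) \<in> borel_measurable M"
  unfolding clip_def
  by (rule measurable_compose[OF _ borel_measurable_continuous_onI])
    (auto intro!: continuous_on_closest_point)

text \<open>If \<open>norm \<beta> \<le> n\<close>, clipping does nothing and only the Taylor
  remainder is left. Otherwise both exponentials are at most \<open>exp (r * norm \<beta>)\<close>,
  and the gap \<open>\<rho> - r\<close> turns \<open>norm \<beta> > n\<close> into the factor
  \<open>exp (- ((\<rho> - r) * n))\<close>.\<close>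

lemma exp_clip_minus_Taylor_le:
  fixes z \<beta> :: complex
  assumes "norm z = r" "0 < r" "r < \<rho>"
  shows "norm (exp (z * clip n \<beta>) - (\<Sum>m\<le>n. (z * \<beta>) ^ m / fact m))
    \<le> (2 * exp (- ((\<rho> - r) * n)) + (r / \<rho>) ^ n) * exp (\<rho> * norm \<beta>)"
proof -
  have taylor: "norm (exp (z * \<beta>) - (\<Sum>m\<le>n. (z * \<beta>) ^ m / fact m)) \<le> (r / \<rho>) ^ n * exp (\<rho> * norm \<beta>)"
    using assms by (intro exp_minus_Taylor_le) (auto simp: norm_mult)
  have "norm (exp (z * clip n \<beta>) - exp (z * \<beta>)) \<le> 2 * exp (- ((\<rho> - r) * n)) * exp (\<rho> * norm \<beta>)"
  proof (cases "norm \<beta> \<le> n")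
    case True
    then show ?thesis by (simp add: clip_id)
  next
    case False
    have "norm (exp (z * c)) \<le> exp (- ((\<rho> - r) * n)) * exp (\<rho> * norm \<beta>)" if "norm c \<le> norm \<beta>" for c
    proof -
      have "norm (exp (z * c)) \<le> exp (r * norm \<beta>)"
        using norm_exp[of "z * c"] assms that
        by (auto simp: norm_mult intro: order_trans mult_left_mono)
      also have "r * norm \<beta> \<le> - ((\<rho> - r) * n) + \<rho> * norm \<beta>"
        using mult_left_mono[of "real n" "norm \<beta>" "\<rho> - r"] False assms by (simp add: algebra_simps)
      finally show ?thesis by (simp add: mult_exp_exp)
    qed
    from this[of "clip n \<beta>"] this[of \<beta>] show ?thesis
      using norm_triangle_ineq4[of "exp (z * clip n \<beta>)" "exp (z * \<beta>)"] norm_clip_le_self[of n \<beta>]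
      by simp
  qed
  then show ?thesis
    using taylor norm_triangle_ineq[of "exp (z * clip n \<beta>) - exp (z * \<beta>)" "exp (z * \<beta>) - (\<Sum>m\<le>n. (z * \<beta>) ^ m / fact m)"]
    by (simp add: distrib_right)
qed

section \<open>The Cauchy integral trick\<close>

lemma function_space_add: "function_space D \<Longrightarrow> f \<in> D \<Longrightarrow> g \<in> D \<Longrightarrow> (\<lambda>x. f x + g x) \<in> D"
  by (simp add: function_space_def)

lemma function_space_mult: "function_space D \<Longrightarrow> f \<in> D \<Longrightarrow> (\<lambda>x. c * f x) \<in> D"
  by (simp add: function_space_def)

lemma linear_operator_add:
  "linear_operator M D S \<Longrightarrow> f \<in> D \<Longrightarrow> g \<in> D \<Longrightarrow> AE x in M. S (\<lambda>y. f y + g y) x = S f x + S g x"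
  by (simp add: linear_operator_def)

lemma linear_operator_mult:
  "linear_operator M D S \<Longrightarrow> f \<in> D \<Longrightarrow> AE x in M. S (\<lambda>y. c * f y) x = scaleC c (S f x)"
  by (simp add: linear_operator_def)

lemma function_space_sum:
  assumes D: "function_space D" and g: "\<And>m. m \<le> n \<Longrightarrow> g m \<in> D"
  shows "(\<lambda>y. \<Sum>m\<le>(n::nat). c m * g m y) \<in> D"
  using g
proof (induction n)
  case 0
  then show ?case using function_space_mult[OF D, of "g 0" "c 0"] by simp
next
  case (Suc n)
  then have "(\<lambda>y. \<Sum>m\<le>n. c m * g m y) \<in> D" "(\<lambda>y. c (Suc n) * g (Suc n) y) \<in> D"
    by (simp_all add: function_space_mult[OF D])
  from function_space_add[OF D this] show ?case by simp
qed

lemma linear_operator_sum: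
  assumes S: "linear_operator M D S" and g: "\<And>m. m \<le> n \<Longrightarrow> g m \<in> D"
  shows "AE x in M. S (\<lambda>y. \<Sum>m\<le>(n::nat). c m * g m y) x = (\<Sum>m\<le>n. scaleC (c m) (S (g m) x))"
  using g
proof (induction n)
  case 0
  then show ?case using linear_operator_mult[OF S, of "g 0" "c 0"] by simp
next
  case (Suc n)
  have D: "function_space D" using S by (simp add: linear_operator_def)
  have "(\<lambda>y. \<Sum>m\<le>n. c m * g m y) \<in> D" using D Suc.prems by (intro function_space_sum) auto
  moreover have "(\<lambda>y. c (Suc n) * g (Suc n) y) \<in> D" using Suc.prems by (simp add: function_space_mult[OF D])
  ultimately have "AE x in M. S (\<lambda>y. (\<Sum>m\<le>n. c m * g m y) + c (Suc n) * g (Suc n) y) x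
      = S (\<lambda>y. \<Sum>m\<le>n. c m * g m y) x + S (\<lambda>y. c (Suc n) * g (Suc n) y) x"
    by (rule linear_operator_add[OF S])
  moreover have "AE x in M. S (\<lambda>y. c (Suc n) * g (Suc n) y) x = scaleC (c (Suc n)) (S (g (Suc n)) x)"
    by (intro linear_operator_mult[OF S] Suc.prems) simp
  moreover have "AE x in M. S (\<lambda>y. \<Sum>m\<le>n. c m * g m y) x = (\<Sum>m\<le>n. scaleC (c m) (S (g m) x))"
    by (rule Suc.IH) (use Suc.prems in auto)
  ultimately show ?case by eventually_elim simp
qed

text \<open>A norm inequality expressed by integrals of powers, with \<open>A\<close> as an upper
  bound for the norm of \<open>g\<close> and \<open>\<Phi>\<close> as operator bound. Membership in
  \<open>D\<close> is included so that linearity can be applied to functions of the weighted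
  space.\<close>

definition bounded_for ::
  "'a measure \<Rightarrow> ('a \<Rightarrow> complex) set \<Rightarrow> (('a \<Rightarrow> complex) \<Rightarrow> 'a \<Rightarrow> complex) \<Rightarrow>
    real \<Rightarrow> real \<Rightarrow> real \<Rightarrow> ('a \<Rightarrow> real) \<Rightarrow> bool"
where
  "bounded_for M D T p q \<Phi> u \<longleftrightarrow> (\<forall>g\<in>borel_measurable M. \<forall>A\<ge>0.
     (\<integral>\<^sup>+x. ennreal ((u x * norm (g x)) powr p) \<partial>M) \<le> ennreal (A powr p) \<longrightarrow>
     g \<in> D \<and> (\<integral>\<^sup>+x. ennreal ((u x * norm (T g x)) powr q) \<partial>M) \<le> ennreal ((\<Phi> * A) powr q))"

lemma bounded_forD:
  assumes "bounded_for M D T p q \<Phi> u" "g \<in> borel_measurable M" "0 \<le> A"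
    "(\<integral>\<^sup>+x. ennreal ((u x * norm (g x)) powr p) \<partial>M) \<le> ennreal (A powr p)"
  shows "g \<in> D \<and> (\<integral>\<^sup>+x. ennreal ((u x * norm (T g x)) powr q) \<partial>M) \<le> ennreal ((\<Phi> * A) powr q)"
  using assms unfolding bounded_for_def by blast

text \<open>Cauchy's estimate: a bound \<open>\<Phi>\<close> that is uniform on the circle of radius
  \<open>r\<close> yields the factor \<open>fact k / r ^ k\<close>. The weight in
  \<open>bdd_norm\<close>, with the larger \<open>\<rho>\<close>, controls only error terms and
  membership in \<open>D\<close>, so it leaves no trace in the final constant.\<close>

lemma commutator_bound:
  fixes \<T> :: "('a \<Rightarrow> complex) \<Rightarrow> 'a \<Rightarrow> 'v::complex_banach"
  assumes lin: "linear_operator M D \<T>"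
    and T_meas: "\<And>g. g \<in> D \<Longrightarrow> T g \<in> borel_measurable M"
    and T_norm: "\<And>g. g \<in> D \<Longrightarrow> AE x in M. norm (\<T> g x) = norm (T g x)"
    and w [measurable]: "w \<in> borel_measurable M" and w_nonneg: "\<And>x. x \<in> space M \<Longrightarrow> 0 \<le> w x"
    and b [measurable]: "b \<in> borel_measurable M"
    and p: "0 < p" and q: "1 \<le> q" and r: "0 < r" "r < \<rho>" and \<Phi>: "0 \<le> \<Phi>" and A: "0 \<le> A"
    and bdd_clip: "\<And>z n. norm z = r \<Longrightarrow>
      bounded_for M D T p q \<Phi> (\<lambda>x. w x * exp (- Re (z * clip (real n) (b x))))"
    and bdd_norm: "bounded_for M D T p q \<Phi> (\<lambda>x. w x * exp (- (\<rho> * norm (b x))))"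
    and f [measurable]: "f \<in> borel_measurable M"
    and f_norm: "(\<integral>\<^sup>+x. ennreal ((w x * norm (f x)) powr p) \<partial>M) \<le> ennreal (A powr p)"
  shows "(\<integral>\<^sup>+x. ennreal ((w x * norm (iter_commutator b k \<T> f x)) powr q) \<partial>M)
    \<le> ennreal ((fact k / r ^ k * (\<Phi> * A)) powr q)"
proof -
  have D: "function_space D" using lin by (simp add: linear_operator_def)
  \<comment> \<open>\<open>\<epsilon>\<close> is the error in \<open>exp_clip_minus_Taylor_le\<close>.\<close>
  define \<epsilon> where "\<epsilon> n = 2 * exp (- ((\<rho> - r) * real n)) + (r / \<rho>) ^ n" for n :: nat
  have \<epsilon>_nonneg: "0 \<le> \<epsilon> n" for n using r by (simp add: \<epsilon>_def)
  have \<epsilon>_lim: "\<epsilon> \<longlonglongrightarrow> 0"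
  proof -
    have "(\<lambda>n. 2 * exp (- (\<rho> - r)) ^ n + (r / \<rho>) ^ n) \<longlonglongrightarrow> 2 * 0 + 0"
      using r by (intro tendsto_intros LIMSEQ_power_zero) auto
    then show ?thesis by (simp add: \<epsilon>_def[abs_def] algebra_simps flip: exp_of_nat_mult)
  qed

  \<comment> \<open>The weight \<open>w exp (- \<rho> \<bar>b\<bar>)\<close> cancels the growth
    allowed for \<open>g\<close>, so the weighted norm of \<open>g\<close> is at most
    \<open>c * A\<close>.\<close>
  have dominated: "g \<in> D \<and>
      (\<integral>\<^sup>+x. ennreal ((w x * exp (- (\<rho> * norm (b x))) * norm (T g x)) powr q) \<partial>M) \<le> ennreal ((\<Phi> * (c * A)) powr q)"
    if g: "g \<in> borel_measurable M" and c: "0 \<le> c"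
      and le: "\<And>x. norm (g x) \<le> c * exp (\<rho> * norm (b x)) * norm (f x)" for g c
  proof -
    have "(\<integral>\<^sup>+x. ennreal ((w x * exp (- (\<rho> * norm (b x))) * norm (g x)) powr p) \<partial>M)
      \<le> (\<integral>\<^sup>+x. ennreal (c powr p) * ennreal ((w x * norm (f x)) powr p) \<partial>M)"
    proof (rule nn_integral_mono)
      fix x assume x: "x \<in> space M"
      have "w x * exp (- (\<rho> * norm (b x))) * norm (g x)
        \<le> w x * exp (- (\<rho> * norm (b x))) * (c * exp (\<rho> * norm (b x)) * norm (f x))"
        using w_nonneg[OF x] by (intro mult_left_mono le) auto
      also have "\<dots> = c * (w x * norm (f x))" by (simp add: exp_minus field_simps)
      finally have "(w x * exp (- (\<rho> * norm (b x))) * norm (g x)) powr p \<le> (c * (w x * norm (f x))) powr p"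
        using w_nonneg[OF x] p by (intro powr_mono2) auto
      then show "ennreal ((w x * exp (- (\<rho> * norm (b x))) * norm (g x)) powr p)
        \<le> ennreal (c powr p) * ennreal ((w x * norm (f x)) powr p)"
        using w_nonneg[OF x] c by (simp add: powr_mult ennreal_leI flip: ennreal_mult)
    qed
    also have "\<dots> = ennreal (c powr p) * (\<integral>\<^sup>+x. ennreal ((w x * norm (f x)) powr p) \<partial>M)"
      by (intro nn_integral_cmult) simp
    also have "\<dots> \<le> ennreal (c powr p) * ennreal (A powr p)"
      by (intro mult_left_mono f_norm) simp
    also have "\<dots> = ennreal ((c * A) powr p)"
      using c A by (simp add: powr_mult ennreal_mult)
    finally show ?thesis
      using c A by (intro bounded_forD[OF bdd_norm g]) auto
  qed

  \<comment> \<open>\<open>G\<close> is \<open>exp (z b) f\<close> with \<open>b\<close> clipped,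
    \<open>S\<close> is the Taylor polynomial of \<open>exp (z b) f\<close> without clipping, and
    \<open>R\<close> is their difference, written with \<open>- 1 * S\<close> to fit the two rules
    of \<open>linear_operator\<close>.\<close>
  define G where "G z n = (\<lambda>x. exp (z * clip (real n) (b x)) * f x)" for z n
  define S where "S z n = (\<lambda>x. \<Sum>m\<le>n. z ^ m / fact m * (b x ^ m * f x))" for z and n :: nat
  define R where "R z n = (\<lambda>x. G z n x + - 1 * S z n x)" for z n
  define V where "V m x = \<T> (\<lambda>y. b y ^ m * f y) x" for m x

  \<comment> \<open>The exponential in the weight is the reciprocal of the modulus of the one in
    \<open>G\<close>, so the weighted norm of \<open>G\<close> equals that of
    \<open>f\<close>.\<close>
  have G: "G z n \<in> D"
      "(\<integral>\<^sup>+x. ennreal ((w x * exp (- Re (z * clip (real n) (b x))) * norm (T (G z n) x)) powr q) \<partial>M)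
        \<le> ennreal ((\<Phi> * A) powr q)" if "norm z = r" for z n
  proof -
    have [measurable]: "G z n \<in> borel_measurable M" unfolding G_def by measurable
    have "w x * exp (- Re (z * clip (real n) (b x))) * norm (G z n x) = w x * norm (f x)" for x
      by (simp add: G_def norm_mult exp_minus field_simps del: minus_complex.sel times_complex.sel)
    then have "(\<integral>\<^sup>+x. ennreal ((w x * exp (- Re (z * clip (real n) (b x))) * norm (G z n x)) powr p) \<partial>M) \<le> ennreal (A powr p)"
      using f_norm by (simp only:)
    with bounded_forD[OF bdd_clip[OF that, of n], of "G z n" A] A show "G z n \<in> D"
      "(\<integral>\<^sup>+x. ennreal ((w x * exp (- Re (z * clip (real n) (b x))) * norm (T (G z n) x)) powr q) \<partial>M)
        \<le> ennreal ((\<Phi> * A) powr q)"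
      by auto
  qed
  have pow_D: "(\<lambda>y. b y ^ m * f y) \<in> D" for m
  proof -
    have "norm (b x) ^ m \<le> fact m / \<rho> ^ m * exp (\<rho> * norm (b x))" for x
      using power_le_fact_times_exp[of "\<rho> * norm (b x)" m] r by (simp add: power_mult_distrib field_simps)
    from mult_right_mono[OF this norm_ge_zero] show ?thesis
      using r by (intro conjunct1[OF dominated[of _ "fact m / \<rho> ^ m"]]) (auto simp: norm_mult norm_power)
  qed
  have S_D: "S z n \<in> D" for z n
    unfolding S_def by (intro function_space_sum D pow_D)
  have R: "R z n \<in> D"
      "(\<integral>\<^sup>+x. ennreal ((w x * exp (- (\<rho> * norm (b x))) * norm (T (R z n) x)) powr q) \<partial>M)
        \<le> ennreal ((\<Phi> * (\<epsilon> n * A)) powr q)" if "norm z = r" for z n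
  proof -
    have "norm (R z n x) \<le> \<epsilon> n * exp (\<rho> * norm (b x)) * norm (f x)" for x
    proof -
      have "R z n x = (exp (z * clip n (b x)) - (\<Sum>m\<le>n. (z * b x) ^ m / fact m)) * f x"
        unfolding R_def G_def S_def left_diff_distrib sum_distrib_right
        by (simp add: power_mult_distrib mult_ac)
      then show ?thesis
        using exp_clip_minus_Taylor_le[OF that r, of n "b x"]
        by (simp add: norm_mult mult_right_mono \<epsilon>_def)
    qed
    moreover have "R z n \<in> borel_measurable M" unfolding R_def G_def S_def by measurable
    ultimately show "R z n \<in> D"
      "(\<integral>\<^sup>+x. ennreal ((w x * exp (- (\<rho> * norm (b x))) * norm (T (R z n) x)) powr q) \<partial>M)
        \<le> ennreal ((\<Phi> * (\<epsilon> n * A)) powr q)"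
      using dominated[of "R z n" "\<epsilon> n"] \<epsilon>_nonneg by auto
  qed
  \<comment> \<open>By linearity the sum is
    \<open>\<T> (S z n) = \<T> (G z n) - \<T> (R z n)\<close>. This passes from possibly
    non-measurable vectors to the measurable functions \<open>T (G z n)\<close> and
    \<open>T (R z n)\<close>.\<close>
  have Taylor_le: "AE x in M. norm (\<Sum>m\<le>n. scaleC (z ^ m / fact m) (V m x)) \<le> norm (T (G z n) x) + norm (T (R z n) x)"
    if z: "norm z = r" for z n
  proof -
    have neg_S: "(\<lambda>x. - 1 * S z n x) \<in> D" by (intro function_space_mult[OF D] S_D)
    have "AE x in M. \<T> (R z n) x = \<T> (G z n) x + \<T> (\<lambda>y. - 1 * S z n y) x"
      unfolding R_def by (rule linear_operator_add[OF lin G(1)[OF z] neg_S])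
    moreover have "AE x in M. \<T> (\<lambda>y. - 1 * S z n y) x = scaleC (- 1) (\<T> (S z n) x)"
      by (rule linear_operator_mult[OF lin S_D])
    moreover have "AE x in M. \<T> (S z n) x = (\<Sum>m\<le>n. scaleC (z ^ m / fact m) (V m x))"
      unfolding S_def V_def by (intro linear_operator_sum[OF lin] pow_D)
    ultimately show ?thesis
      using T_norm[OF G(1)[OF z, of n]] T_norm[OF R(1)[OF z, of n]]
    proof eventually_elim
      case (elim x)
      then have "(\<Sum>m\<le>n. scaleC (z ^ m / fact m) (V m x)) = \<T> (G z n) x - \<T> (R z n) x"
        by (simp add: scaleC_minus_left)
      then show ?case
        using norm_triangle_ineq4[of "\<T> (G z n) x" "\<T> (R z n) x"] elim by simp
    qed
  qed

  define \<delta> where "\<delta> J = 1 / real (Suc J)" for J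
  have \<delta>_pos: "0 < \<delta> J" for J by (simp add: \<delta>_def)
  \<comment> \<open>Where \<open>\<bar>b\<bar> \<le> J\<close>, exchanging the error weight for
    \<open>w exp (- Re (z b))\<close> costs at most \<open>exp ((r + \<rho>) * J)\<close>, and
    \<open>n\<close> is so large that the error stays below \<open>\<delta> J\<close> all the same.
    \<open>k \<le> n\<close> keeps the coefficient of index \<open>k\<close>, and
    \<open>J \<le> n\<close> makes clipping trivial on this set.\<close>
  have "\<exists>n. k \<le> n \<and> J \<le> n \<and> exp ((r + \<rho>) * real J) * (\<Phi> * (\<epsilon> n * A)) \<le> \<delta> J" for J
  proof -
    have "(\<lambda>n. exp ((r + \<rho>) * real J) * (\<Phi> * (\<epsilon> n * A))) \<longlonglongrightarrow> exp ((r + \<rho>) * real J) * (\<Phi> * (0 * A))"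
      by (intro tendsto_intros \<epsilon>_lim)
    then have "\<forall>\<^sub>F n in sequentially. exp ((r + \<rho>) * real J) * (\<Phi> * (\<epsilon> n * A)) < \<delta> J"
      using \<delta>_pos by (intro order_tendstoD) auto
    with eventually_ge_at_top[of k] eventually_ge_at_top[of J]
    have "\<forall>\<^sub>F n in sequentially. k \<le> n \<and> J \<le> n \<and> exp ((r + \<rho>) * real J) * (\<Phi> * (\<epsilon> n * A)) \<le> \<delta> J"
      by eventually_elim auto
    then show ?thesis by (rule eventually_happens'[OF sequentially_bot])
  qed
  then obtain n where n: "\<And>J. k \<le> n J" "\<And>J. J \<le> n J"
      "\<And>J. exp ((r + \<rho>) * real J) * (\<Phi> * (\<epsilon> (n J) * A)) \<le> \<delta> J"
    by metis

  \<comment> \<open>On \<open>\<bar>b\<bar> \<le> J\<close>, \<open>\<alpha>\<close> is the main part and \<open>\<beta>\<close> majorizes the remainder of the averages \<open>avg\<close>.\<close>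
  define \<alpha> where "\<alpha> J N j = (\<lambda>x. w x * exp (- Re (circle_point r N j * clip (real (n J)) (b x)))
    * norm (T (G (circle_point r N j) (n J)) x))" for J N j
  define \<beta> where "\<beta> J N j = (\<lambda>x. exp ((r + \<rho>) * real J) *
    (w x * exp (- (\<rho> * norm (b x))) * norm (T (R (circle_point r N j) (n J)) x)))" for J N j
  have circ: "norm (circle_point r N j) = r" for N j using r by simp
  have TR [measurable]: "T (R (circle_point r N j) n) \<in> borel_measurable M" for N j n
    by (intro T_meas R circ)
  have [measurable]: "T (G (circle_point r N j) n) \<in> borel_measurable M" for N j n
    by (intro T_meas G circ)
  have [measurable]: "\<alpha> J N j \<in> borel_measurable M" "\<beta> J N j \<in> borel_measurable M" for J N j
    unfolding \<alpha>_def \<beta>_def by simp_all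
  have \<alpha>\<beta>_nonneg: "0 \<le> \<alpha> J N j x" "0 \<le> \<beta> J N j x" if "x \<in> space M" for J N j x
    using w_nonneg[OF that] by (auto simp: \<alpha>_def \<beta>_def)
  define H where "H J N x = ennreal (((\<Sum>j<N. \<alpha> J N j x + \<beta> J N j x) / real N) powr q)" for J N x
  have [measurable]: "H J N \<in> borel_measurable M" for J N unfolding H_def by measurable

  have H_int: "(\<integral>\<^sup>+x. H J N x \<partial>M) \<le> ennreal ((\<Phi> * A + 2 * \<delta> J) powr q)" for J N
  proof (cases "N = 0")
    case True
    then show ?thesis by (simp add: H_def)
  next
    case False
    have \<beta>_int: "(\<integral>\<^sup>+x. ennreal (\<beta> J N j x powr q) \<partial>M) \<le> ennreal (\<delta> J powr q)" for j
    proof -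
      have "(\<integral>\<^sup>+x. ennreal (\<beta> J N j x powr q) \<partial>M)
        = (\<integral>\<^sup>+x. ennreal (exp ((r + \<rho>) * real J) powr q) * ennreal ((w x * exp (- (\<rho> * norm (b x))) * norm (T (R (circle_point r N j) (n J)) x)) powr q) \<partial>M)"
        unfolding \<beta>_def using w_nonneg by (intro nn_integral_cong) (simp add: powr_mult ennreal_mult)
      also have "\<dots> = ennreal (exp ((r + \<rho>) * real J) powr q) * (\<integral>\<^sup>+x. ennreal ((w x * exp (- (\<rho> * norm (b x))) * norm (T (R (circle_point r N j) (n J)) x)) powr q) \<partial>M)"
        by (intro nn_integral_cmult) simp
      also have "\<dots> \<le> ennreal (exp ((r + \<rho>) * real J) powr q) * ennreal ((\<Phi> * (\<epsilon> (n J) * A)) powr q)"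
        by (intro mult_left_mono R circ) simp
      also have "\<dots> = ennreal ((exp ((r + \<rho>) * real J) * (\<Phi> * (\<epsilon> (n J) * A))) powr q)"
        using \<Phi> A \<epsilon>_nonneg by (simp add: powr_mult ennreal_mult)
      also have "\<dots> \<le> ennreal (\<delta> J powr q)"
        using \<Phi> A \<epsilon>_nonneg n(3) q by (intro ennreal_leI powr_mono2) auto
      finally show ?thesis .
    qed
    \<comment> \<open>The extra \<open>\<delta> J\<close> makes the bound positive even if
      \<open>\<Phi> * A = 0\<close>, as \<open>nn_integral_mean_powr_le\<close> demands; with the
      bound for \<open>\<beta>\<close> it gives \<open>2 * \<delta> J\<close>.\<close>
    have \<alpha>_int: "(\<integral>\<^sup>+x. ennreal (\<alpha> J N j x powr q) \<partial>M) \<le> ennreal ((\<Phi> * A + \<delta> J) powr q)" for j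
    proof -
      have "(\<integral>\<^sup>+x. ennreal (\<alpha> J N j x powr q) \<partial>M) \<le> ennreal ((\<Phi> * A) powr q)"
        unfolding \<alpha>_def by (rule G(2)[OF circ])
      also have "\<dots> \<le> ennreal ((\<Phi> * A + \<delta> J) powr q)"
        using \<Phi> A \<delta>_pos[of J] q by (intro ennreal_leI powr_mono2) auto
      finally show ?thesis .
    qed
    have "(\<integral>\<^sup>+x. H J N x \<partial>M) \<le> ennreal ((\<Phi> * A + \<delta> J + \<delta> J) powr q)"
      unfolding H_def
    proof (rule nn_integral_mean_powr_le[OF q])
      show "0 < \<Phi> * A + \<delta> J" using \<Phi> A \<delta>_pos[of J] by (simp add: add_nonneg_pos)
    qed (use False \<delta>_pos \<alpha>\<beta>_nonneg \<alpha>_int \<beta>_int in auto)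
    then show ?thesis by (simp add: add_ac)
  qed

  \<comment> \<open>Here \<open>avg\<close> is the discrete contour integral at the point
    \<open>x\<close>, not the mean over a set of the basis.\<close>
  define avg where "avg J N x = (\<Sum>j<N. scaleC (exp (- circle_point r N j * b x) / circle_point r N j ^ k / of_nat N)
      (\<Sum>m\<le>n J. scaleC (circle_point r N j ^ m / fact m) (V m x)))" for J N x
  have avg_lim: "(\<lambda>N. avg J N x) \<longlonglongrightarrow> scaleC (1 / fact k) (iter_commutator b k \<T> f x)" for J x
    unfolding avg_def V_def by (rule circle_average_iter_commutator[OF r(1) n(1)])

  \<comment> \<open>The exceptional set of \<open>Taylor_le\<close> depends on \<open>z\<close> and
    the degree, but only countably many pairs occur, so one null set serves for all.\<close>
  have "AE x in M. \<forall>J N j. norm (\<Sum>m\<le>n J. scaleC (circle_point r N j ^ m / fact m) (V m x))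
      \<le> norm (T (G (circle_point r N j) (n J)) x) + norm (T (R (circle_point r N j) (n J)) x)"
    by (intro AE_all_countable[THEN iffD2] allI Taylor_le circ)
  then have avg_le: "AE x in M. \<forall>J N. norm (b x) \<le> real J \<longrightarrow>
      r ^ k * (w x * norm (avg J N x)) \<le> (\<Sum>j<N. \<alpha> J N j x + \<beta> J N j x) / real N"
    using AE_space
  proof eventually_elim
    case (elim x)
    show ?case
    proof (intro allI impI)
      fix J N assume J: "norm (b x) \<le> real J"
      have clip: "clip (real (n J)) (b x) = b x"
        using J n(2)[of J] by (intro clip_id) linarith
      let ?z = "circle_point r N"
      let ?s = "\<lambda>j. \<Sum>m\<le>n J. scaleC (?z j ^ m / fact m) (V m x)"
      have "r ^ k * (w x * norm (avg J N x)) \<le> r ^ k * (w x * (\<Sum>j<N. exp (- Re (?z j * b x)) / r ^ k / real N * norm (?s j)))"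
        unfolding avg_def using w_nonneg[OF elim(2)] r
        by (intro mult_left_mono sum_norm_le)
          (auto simp: norm_scaleC norm_divide norm_power norm_mult circ del: minus_complex.sel times_complex.sel)
      also have "\<dots> = (\<Sum>j<N. w x * exp (- Re (?z j * b x)) * norm (?s j)) / real N"
        using r by (simp add: sum_distrib_left sum_divide_distrib mult_ac)
      also have "\<dots> \<le> (\<Sum>j<N. \<alpha> J N j x + \<beta> J N j x) / real N"
      proof (intro divide_right_mono sum_mono)
        fix j
        have "exp (- Re (?z j * b x)) \<le> exp ((r + \<rho>) * real J) * exp (- (\<rho> * norm (b x)))"
        proof -
          have "- Re (?z j * b x) \<le> norm (?z j * b x)" using abs_Re_le_cmod[of "?z j * b x"] by linarith
          also have "\<dots> = (r + \<rho>) * norm (b x) - \<rho> * norm (b x)" by (simp add: norm_mult circ algebra_simps)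
          also have "\<dots> \<le> (r + \<rho>) * real J - \<rho> * norm (b x)" using J r by (intro diff_right_mono mult_left_mono) auto
          finally show ?thesis by (simp add: mult_exp_exp)
        qed
        from mult_left_mono[OF this, of "w x * norm (T (R (?z j) (n J)) x)"]
        have "w x * exp (- Re (?z j * b x)) * norm (T (R (?z j) (n J)) x) \<le> \<beta> J N j x"
          using w_nonneg[OF elim(2)] by (simp add: \<beta>_def mult_ac)
        moreover have "w x * exp (- Re (?z j * b x)) * norm (?s j)
          \<le> w x * exp (- Re (?z j * b x)) * (norm (T (G (?z j) (n J)) x) + norm (T (R (?z j) (n J)) x))"
          using elim w_nonneg by (intro mult_left_mono) auto
        ultimately show "w x * exp (- Re (?z j * b x)) * norm (?s j) \<le> \<alpha> J N j x + \<beta> J N j x"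
          by (simp add: \<alpha>_def clip distrib_left)
      qed simp
      finally show "r ^ k * (w x * norm (avg J N x)) \<le> (\<Sum>j<N. \<alpha> J N j x + \<beta> J N j x) / real N" .
    qed
  qed

  define c where "c = fact k / r ^ k"
  have c: "0 < c" using r by (simp add: c_def)
  \<comment> \<open>The limit in \<open>N\<close> comes first, at fixed \<open>J\<close>; by
    \<open>avg_lim\<close> its value is the same for every \<open>J\<close>, and the majorant
    \<open>H\<close> is available as soon as \<open>norm (b x) \<le> J\<close>.\<close>
  have pointwise: "AE x in M. ennreal ((w x * norm (iter_commutator b k \<T> f x)) powr q)
      \<le> ennreal (c powr q) * liminf (\<lambda>J. liminf (\<lambda>N. H J N x))"
    using avg_le AE_space
  proof eventually_elim
    case (elim x)
    let ?y = "r ^ k * (w x * norm (scaleC (1 / fact k) (iter_commutator b k \<T> f x)))"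
    have le_H: "ennreal (?y powr q) \<le> liminf (\<lambda>N. H J N x)" if J: "norm (b x) \<le> real J" for J
    proof -
      have "(\<lambda>N. ennreal ((r ^ k * (w x * norm (avg J N x))) powr q)) \<longlonglongrightarrow> ennreal (?y powr q)"
        using r w_nonneg[OF elim(2)] q
        by (intro tendsto_ennrealI tendsto_powr' tendsto_mult tendsto_const tendsto_norm avg_lim) auto
      then have "ennreal (?y powr q) = liminf (\<lambda>N. ennreal ((r ^ k * (w x * norm (avg J N x))) powr q))"
        by (intro lim_imp_Liminf[symmetric]) auto
      also have "\<dots> \<le> liminf (\<lambda>N. H J N x)"
        using elim J r q w_nonneg unfolding H_def
        by (intro Liminf_mono always_eventually allI ennreal_leI powr_mono2) auto
      finally show ?thesis .
    qed
    have "\<forall>\<^sub>F J in sequentially. ennreal (?y powr q) \<le> liminf (\<lambda>N. H J N x)"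
      using eventually_ge_at_top[of "nat \<lceil>norm (b x)\<rceil>"]
      by eventually_elim (simp add: le_H nat_ceiling_le_eq)
    then have "ennreal (?y powr q) \<le> liminf (\<lambda>J. liminf (\<lambda>N. H J N x))"
      by (rule Liminf_bounded)
    then have "ennreal (c powr q) * ennreal (?y powr q) \<le> ennreal (c powr q) * liminf (\<lambda>J. liminf (\<lambda>N. H J N x))"
      by (rule mult_left_mono) simp
    moreover have "w x * norm (iter_commutator b k \<T> f x) = c * ?y"
      using r by (simp add: norm_scaleC norm_divide c_def)
    moreover have "ennreal ((c * ?y) powr q) = ennreal (c powr q) * ennreal (?y powr q)"
      using c r w_nonneg[OF elim(2)] by (subst powr_mult) (auto simp: ennreal_mult simp del: norm_scaleC)
    ultimately show ?case by (simp only:)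
  qed
  \<comment> \<open>If the commutator is not measurable, the left side is a lower integral, which is
    still monotone. Fatou's lemma is then applied twice, to the measurable \<open>H\<close>
    only.\<close>
  have "(\<integral>\<^sup>+x. ennreal ((w x * norm (iter_commutator b k \<T> f x)) powr q) \<partial>M)
    \<le> (\<integral>\<^sup>+x. ennreal (c powr q) * liminf (\<lambda>J. liminf (\<lambda>N. H J N x)) \<partial>M)"
    using pointwise by (rule nn_integral_mono_AE)
  also have "\<dots> = ennreal (c powr q) * (\<integral>\<^sup>+x. liminf (\<lambda>J. liminf (\<lambda>N. H J N x)) \<partial>M)"
    by (intro nn_integral_cmult) measurable
  also have "(\<integral>\<^sup>+x. liminf (\<lambda>J. liminf (\<lambda>N. H J N x)) \<partial>M) \<le> ennreal ((\<Phi> * A) powr q)"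
  proof -
    have "(\<integral>\<^sup>+x. liminf (\<lambda>J. liminf (\<lambda>N. H J N x)) \<partial>M) \<le> liminf (\<lambda>J. \<integral>\<^sup>+x. liminf (\<lambda>N. H J N x) \<partial>M)"
      by (intro nn_integral_liminf) measurable
    also have "\<dots> \<le> liminf (\<lambda>J. ennreal ((\<Phi> * A + 2 * \<delta> J) powr q))"
    proof (intro Liminf_mono always_eventually allI)
      fix J
      have "(\<integral>\<^sup>+x. liminf (\<lambda>N. H J N x) \<partial>M) \<le> liminf (\<lambda>N. \<integral>\<^sup>+x. H J N x \<partial>M)"
        by (intro nn_integral_liminf) measurable
      also have "\<dots> \<le> liminf (\<lambda>N::nat. ennreal ((\<Phi> * A + 2 * \<delta> J) powr q))"
        by (intro Liminf_mono always_eventually allI H_int)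
      finally show "(\<integral>\<^sup>+x. liminf (\<lambda>N. H J N x) \<partial>M) \<le> ennreal ((\<Phi> * A + 2 * \<delta> J) powr q)"
        by (simp add: Liminf_const)
    qed
    also have "\<dots> = ennreal ((\<Phi> * A) powr q)"
    proof (rule lim_imp_Liminf)
      have "(\<lambda>J. \<Phi> * A + 2 * \<delta> J) \<longlonglongrightarrow> \<Phi> * A + 2 * 0"
        unfolding \<delta>_def by (intro tendsto_intros LIMSEQ_inverse_real_of_nat[unfolded inverse_eq_divide])
      then show "(\<lambda>J. ennreal ((\<Phi> * A + 2 * \<delta> J) powr q)) \<longlonglongrightarrow> ennreal ((\<Phi> * A) powr q)"
        using q \<Phi> A \<delta>_pos
        by (intro tendsto_ennrealI tendsto_powr' tendsto_const) (auto intro!: always_eventually add_nonneg_nonneg less_imp_le)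
    qed simp
    finally show ?thesis .
  qed
  also have "ennreal (c powr q) * ennreal ((\<Phi> * A) powr q) = ennreal ((c * (\<Phi> * A)) powr q)"
    using c \<Phi> A by (simp add: powr_mult flip: ennreal_mult)
  finally show ?thesis by (simp add: c_def mult_left_mono)
qed

section \<open>Weighted norms\<close>

lemma epowr_le_iff:
  assumes "0 < p" "0 \<le> A"
  shows "epowr I (1 / p) \<le> ennreal A \<longleftrightarrow> I \<le> ennreal (A powr p)"
proof (cases I)
  case (real i)
  have "i powr (1 / p) \<le> A \<longleftrightarrow> i \<le> A powr p"
  proof
    assume "i powr (1 / p) \<le> A"
    then have "(i powr (1 / p)) powr p \<le> A powr p" using assms by (intro powr_mono2) auto
    then show "i \<le> A powr p" using assms real by (simp add: powr_powr)
  next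
    assume "i \<le> A powr p"
    then have "i powr (1 / p) \<le> (A powr p) powr (1 / p)" using assms real by (intro powr_mono2) auto
    then show "i powr (1 / p) \<le> A" using assms by (simp add: powr_powr)
  qed
  then show ?thesis using real assms by (simp add: epowr_ennreal_nonneg)
next
  case top
  then show ?thesis using assms by (simp add: epowr_def top_unique)
qed

text \<open>For non-measurable \<open>F\<close> (such as the norm of a commutator) the integral is a lower integral, and equality may fail.\<close>

lemma nn_integral_density_le:
  assumes [measurable]: "g \<in> borel_measurable M"
  shows "(\<integral>\<^sup>+x. F x \<partial>density M g) \<le> (\<integral>\<^sup>+x. g x * F x \<partial>M)"
proof -
  \<comment> \<open>The integral of \<open>F\<close> is a supremum over simple functions below
    \<open>F\<close>, and these are measurable, so the density formula applies to them.\<close>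
  have "integral\<^sup>S (density M g) h \<le> (\<integral>\<^sup>+x. g x * F x \<partial>M)"
    if h: "simple_function (density M g) h" "h \<le> F" for h
  proof -
    have [measurable]: "h \<in> borel_measurable M"
      using borel_measurable_simple_function[OF h(1)] by simp
    have "integral\<^sup>S (density M g) h = (\<integral>\<^sup>+x. h x \<partial>density M g)"
      using h(1) by (rule nn_integral_eq_simple_integral[symmetric])
    also have "\<dots> = (\<integral>\<^sup>+x. g x * h x \<partial>M)" by (rule nn_integral_density) auto
    also have "\<dots> \<le> (\<integral>\<^sup>+x. g x * F x \<partial>M)"
      using h(2) by (intro nn_integral_mono mult_left_mono) (auto simp: le_fun_def)
    finally show ?thesis .
  qed
  then show ?thesis unfolding nn_integral_def[of "density M g"] by (intro SUP_least) auto
qed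

lemma weighted_power_eq:
  assumes "0 \<le> (u::real)"
  shows "ennreal (u powr p) * ennreal (norm y powr p) = ennreal ((u * norm y) powr p)"
  using assms by (simp add: powr_mult ennreal_mult)

lemma Lp_norm_le_iff:
  assumes [measurable]: "u \<in> borel_measurable M" "g \<in> borel_measurable M"
    and u: "\<And>x. x \<in> space M \<Longrightarrow> 0 \<le> u x" and pA: "0 < p" "0 \<le> A"
  shows "Lp_norm M p (\<lambda>x. u x powr p) g \<le> ennreal A
    \<longleftrightarrow> (\<integral>\<^sup>+x. ennreal ((u x * norm (g x)) powr p) \<partial>M) \<le> ennreal (A powr p)"
proof -
  have "(\<integral>\<^sup>+x. ennreal (norm (g x) powr p) \<partial>density M (\<lambda>x. ennreal (u x powr p)))
    = (\<integral>\<^sup>+x. ennreal ((u x * norm (g x)) powr p) \<partial>M)"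
    using u by (subst nn_integral_density) (auto intro!: nn_integral_cong weighted_power_eq)
  then show ?thesis unfolding Lp_norm_def by (simp only: epowr_le_iff[OF pA])
qed

text \<open>The direction that survives for a possibly non-measurable \<open>g\<close>, meant for
  the commutator itself.\<close>

lemma Lp_norm_leI:
  assumes [measurable]: "u \<in> borel_measurable M"
    and u: "\<And>x. x \<in> space M \<Longrightarrow> 0 \<le> u x" and pA: "0 < p" "0 \<le> A"
    and le: "(\<integral>\<^sup>+x. ennreal ((u x * norm (g x)) powr p) \<partial>M) \<le> ennreal (A powr p)"
  shows "Lp_norm M p (\<lambda>x. u x powr p) g \<le> ennreal A"
proof -
  have "(\<integral>\<^sup>+x. ennreal (norm (g x) powr p) \<partial>density M (\<lambda>x. ennreal (u x powr p)))
    \<le> (\<integral>\<^sup>+x. ennreal (u x powr p) * ennreal (norm (g x) powr p) \<partial>M)"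
    by (rule nn_integral_density_le) simp
  also have "\<dots> = (\<integral>\<^sup>+x. ennreal ((u x * norm (g x)) powr p) \<partial>M)"
    using u by (intro nn_integral_cong weighted_power_eq) auto
  finally show ?thesis unfolding Lp_norm_def using le by (simp only: epowr_le_iff[OF pA] order_trans)
qed

section \<open>Commutators with functions of bounded mean oscillation\<close>

text \<open>The infimum defining the norm need not be attained: strictness provides an admissible
  \<open>t0 < t\<close>, and passing from \<open>t0\<close> to \<open>t\<close> decreases the
  integrand.\<close>

lemma BMO_norm_less_imp_avg_le:
  assumes B: "B \<in> \<B>" and less: "BMO_norm M \<B> b < ennreal t"
  shows "nn_avg M B (\<lambda>x. ennreal (exp (norm (b x - avg M B b) / t))) \<le> 2"
proof -
  have "expL_norm M B (\<lambda>x. b x - avg M B b) \<le> BMO_norm M \<B> b"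
    unfolding BMO_norm_def using B by (rule SUP_upper)
  then have "expL_norm M B (\<lambda>x. b x - avg M B b) < ennreal t" using less by (rule le_less_trans)
  then obtain t0 where t0: "0 < t0" "ennreal t0 < ennreal t"
      "nn_avg M B (\<lambda>x. ennreal (exp (norm (b x - avg M B b) / t0))) \<le> 2"
    unfolding expL_norm_def INF_less_iff by auto
  then have "t0 < t" by (simp add: ennreal_less_iff)
  then have "nn_avg M B (\<lambda>x. ennreal (exp (norm (b x - avg M B b) / t)))
    \<le> nn_avg M B (\<lambda>x. ennreal (exp (norm (b x - avg M B b) / t0)))"
    unfolding nn_avg_def using t0
    by (intro divide_right_mono_ennreal nn_integral_mono mult_right_mono ennreal_leI)
      (auto intro: divide_left_mono)
  then show ?thesis using t0(3) by (rule order_trans)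
qed

lemma nn_avg_mono: "(\<And>x. g x \<le> h x) \<Longrightarrow> nn_avg M B g \<le> nn_avg M B h"
  unfolding nn_avg_def by (intro divide_right_mono_ennreal nn_integral_mono mult_right_mono) auto

text \<open>The hypothesis on \<open>T\<close> is applied to the weight \<open>w exp (- h)\<close>.
  The lower bound for \<open>h\<close> makes it locally integrable;
  \<open>Muckenhoupt_times_exp\<close> and the monotonicity of \<open>\<phi>\<close> make the bound
  independent of \<open>h\<close>.\<close>

lemma bounded_for_perturbed_weight:
  fixes T :: "('a \<Rightarrow> complex) \<Rightarrow> 'a \<Rightarrow> complex"
  assumes basis: "is_basis M \<B>"
    and T_meas: "\<And>f. f \<in> D \<Longrightarrow> T f \<in> borel_measurable M"
    and exps: "1 \<le> p" "1 \<le> q" "0 < \<theta>" "1 < s" "1 < \<eta>" "1 / \<eta> + 1 / \<eta>' = 1"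
    and \<phi>_mono: "mono_on {1..} \<phi>"
    and T_bdd: "\<And>w f. weight M \<B> w \<Longrightarrow> (\<lambda>x. w x powr \<theta>) \<in> Muckenhoupt M \<B> s \<Longrightarrow>
         f \<in> Lp M p (\<lambda>x. w x powr p) \<Longrightarrow>
         f \<in> D \<and>
         Lp_norm M q (\<lambda>x. w x powr q) (T f) \<le>
           ennreal (\<phi> (enn2real (Muckenhoupt_const M \<B> s (\<lambda>x. w x powr \<theta>)))) *
           Lp_norm M p (\<lambda>x. w x powr p) f"
    and w: "weight M \<B> w" and W: "(\<lambda>x. w x powr (\<theta> * \<eta>)) \<in> Muckenhoupt M \<B> s"
    and h [measurable]: "h \<in> borel_measurable M" and h_ge: "\<And>x. - C \<le> h x"
    and osc: "\<And>B. B \<in> \<B> \<Longrightarrow> \<exists>c. nn_avg M B (\<lambda>x. ennreal (exp (\<theta> * \<eta>' * \<bar>h x - c\<bar> / min 1 (s - 1)))) \<le> 2"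
  defines "\<kappa> \<equiv> 4 powr (min 1 (s - 1) / \<eta>') *
      enn2real (Muckenhoupt_const M \<B> s (\<lambda>x. w x powr (\<theta> * \<eta>))) powr (1 / \<eta>)"
  shows "bounded_for M D T p q (max 0 (\<phi> \<kappa>)) (\<lambda>x. w x * exp (- h x))"
proof -
  let ?u = "\<lambda>x. w x * exp (- h x)"
  have w_meas [measurable]: "w \<in> borel_measurable M" and w_nonneg: "\<And>x. x \<in> space M \<Longrightarrow> 0 \<le> w x"
    and w_int: "\<And>B. B \<in> \<B> \<Longrightarrow> (\<integral>\<^sup>+x\<in>B. ennreal (w x) \<partial>M) < \<infinity>"
    using w by (auto simp: weight_def)
  note muck = Muckenhoupt_times_exp[OF basis exps(4,3,5,6) w_meas w_nonneg W h osc, folded \<kappa>_def]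
  have u_nonneg: "\<And>x. x \<in> space M \<Longrightarrow> 0 \<le> ?u x" using w_nonneg by simp
  have "(\<integral>\<^sup>+x\<in>B. ennreal (?u x) \<partial>M) < \<infinity>" if B: "B \<in> \<B>" for B
  proof -
    have [measurable]: "B \<in> sets M" using basis B by (auto simp: is_basis_def)
    have "(\<integral>\<^sup>+x\<in>B. ennreal (?u x) \<partial>M) \<le> (\<integral>\<^sup>+x. ennreal (exp C) * (ennreal (w x) * indicator B x) \<partial>M)"
    proof (rule nn_integral_mono)
      fix x assume x: "x \<in> space M"
      have "?u x \<le> exp C * w x"
        using mult_left_mono[of "exp (- h x)" "exp C" "w x"] h_ge[of x] w_nonneg[OF x]
        by (simp add: mult.commute)
      then have "ennreal (?u x) \<le> ennreal (exp C) * ennreal (w x)"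
        using w_nonneg[OF x] by (simp add: ennreal_leI flip: ennreal_mult)
      then show "ennreal (?u x) * indicator B x \<le> ennreal (exp C) * (ennreal (w x) * indicator B x)"
        by (simp add: mult_right_mono flip: mult.assoc)
    qed
    also have "\<dots> = ennreal (exp C) * (\<integral>\<^sup>+x\<in>B. ennreal (w x) \<partial>M)"
      by (intro nn_integral_cmult) simp
    also have "\<dots> < \<infinity>" using w_int[OF B] by (simp add: ennreal_mult_less_top)
    finally show ?thesis .
  qed
  then have u_weight: "weight M \<B> ?u" using u_nonneg by (simp add: weight_def)
  have \<phi>_le: "\<phi> (enn2real (Muckenhoupt_const M \<B> s (\<lambda>x. ?u x powr \<theta>))) \<le> \<phi> \<kappa>"
  \<comment> \<open>Over an empty basis both arguments of \<open>\<phi>\<close> are zero: the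
    supremum over no sets is zero, and \<open>0 powr (1 / \<eta>) = 0\<close>.\<close>
  proof (cases "\<B> = {}")
    case True
    then show ?thesis by (simp add: \<kappa>_def Muckenhoupt_const_def bot_ennreal)
  next
    case False
    have "0 \<le> \<kappa>" by (simp add: \<kappa>_def)
    have "1 \<le> enn2real (Muckenhoupt_const M \<B> s (\<lambda>x. ?u x powr \<theta>))"
      by (rule Muckenhoupt_const_ge_1[OF basis exps(4) muck(1) False])
    moreover have "enn2real (Muckenhoupt_const M \<B> s (\<lambda>x. ?u x powr \<theta>)) \<le> \<kappa>"
      using muck(2) \<open>0 \<le> \<kappa>\<close> by (simp add: enn2real_leI)
    ultimately show ?thesis by (intro mono_onD[OF \<phi>_mono]) auto
  qed
  show ?thesis
    unfolding bounded_for_def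
  proof (intro ballI allI impI)
    fix g :: "'a \<Rightarrow> complex" and A assume g [measurable]: "g \<in> borel_measurable M" and A: "0 \<le> A"
      and int: "(\<integral>\<^sup>+x. ennreal ((?u x * norm (g x)) powr p) \<partial>M) \<le> ennreal (A powr p)"
    have norm_le: "Lp_norm M p (\<lambda>x. ?u x powr p) g \<le> ennreal A"
      using int exps A u_nonneg by (subst Lp_norm_le_iff) auto
    then have "g \<in> Lp M p (\<lambda>x. ?u x powr p)" by (auto simp: Lp_def intro: le_less_trans)
    from T_bdd[OF u_weight muck(1) this] have gD: "g \<in> D"
      and Tg: "Lp_norm M q (\<lambda>x. ?u x powr q) (T g) \<le>
        ennreal (\<phi> (enn2real (Muckenhoupt_const M \<B> s (\<lambda>x. ?u x powr \<theta>)))) * Lp_norm M p (\<lambda>x. ?u x powr p) g"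
      by auto
    note Tg
    also have "\<dots> \<le> ennreal (max 0 (\<phi> \<kappa>)) * ennreal A"
      using \<phi>_le norm_le by (intro mult_mono ennreal_leI) auto
    also have "\<dots> = ennreal (max 0 (\<phi> \<kappa>) * A)" using A by (simp add: ennreal_mult)
    finally have "(\<integral>\<^sup>+x. ennreal ((?u x * norm (T g x)) powr q) \<partial>M) \<le> ennreal ((max 0 (\<phi> \<kappa>) * A) powr q)"
      using exps A u_nonneg T_meas[OF gD] by (subst (asm) Lp_norm_le_iff) auto
    with gD show "g \<in> D \<and> (\<integral>\<^sup>+x. ennreal ((?u x * norm (T g x)) powr q) \<partial>M) \<le> ennreal ((max 0 (\<phi> \<kappa>) * A) powr q)"
      by simp
  qed
qed

text \<open>For \<open>t\<close> above the BMO norm, the radius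
  \<open>m / (\<theta> * \<eta>' * t)\<close> is admissible in \<open>commutator_bound\<close> and
  produces the constant of the theorem. Stating the result for any \<open>F\<close> with the same
  pointwise norm treats linear and linearizable operators together.\<close>

lemma Lp_norm_commutator_le:
  fixes T :: "('a \<Rightarrow> complex) \<Rightarrow> 'a \<Rightarrow> complex"
    and \<T> :: "('a \<Rightarrow> complex) \<Rightarrow> 'a \<Rightarrow> 'v::complex_banach"
  assumes basis: "is_basis M \<B>"
    and lin: "linear_operator M D \<T>"
    and T_norm: "\<And>f. f \<in> D \<Longrightarrow> AE x in M. norm (\<T> f x) = norm (T f x)"
    and T_meas: "\<And>f. f \<in> D \<Longrightarrow> T f \<in> borel_measurable M"
    and exps: "1 \<le> p" "1 \<le> q" "0 < \<theta>" "1 < s" "1 < \<eta>" "1 / \<eta> + 1 / \<eta>' = 1"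
    and \<phi>_mono: "mono_on {1..} \<phi>"
    and T_bdd: "\<And>w f. weight M \<B> w \<Longrightarrow> (\<lambda>x. w x powr \<theta>) \<in> Muckenhoupt M \<B> s \<Longrightarrow>
         f \<in> Lp M p (\<lambda>x. w x powr p) \<Longrightarrow>
         f \<in> D \<and>
         Lp_norm M q (\<lambda>x. w x powr q) (T f) \<le>
           ennreal (\<phi> (enn2real (Muckenhoupt_const M \<B> s (\<lambda>x. w x powr \<theta>)))) *
           Lp_norm M p (\<lambda>x. w x powr p) f"
    and b: "b \<in> BMO M \<B>"
    and w: "weight M \<B> w" and W: "(\<lambda>x. w x powr (\<theta> * \<eta>)) \<in> Muckenhoupt M \<B> s"
    and f: "f \<in> Lp M p (\<lambda>x. w x powr p)"
    and F: "\<And>x. norm (F x) = norm (iter_commutator b k \<T> f x)"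
  shows "Lp_norm M q (\<lambda>x. w x powr q) F \<le>
          ennreal (fact k * (\<eta>' * \<theta> / min 1 (s - 1)) ^ k) *
          ennreal (\<phi> (4 powr (min 1 (s - 1) / \<eta>') *
            enn2real (Muckenhoupt_const M \<B> s (\<lambda>x. w x powr (\<theta> * \<eta>))) powr (1 / \<eta>))) *
          BMO_norm M \<B> b ^ k *
          Lp_norm M p (\<lambda>x. w x powr p) f"
proof -
  define m where "m = min 1 (s - 1)"
  \<comment> \<open>Taking \<open>max 0\<close> agrees with \<open>ennreal\<close>, which sends
    negative reals to zero.\<close>
  define \<Phi> where "\<Phi> = max 0 (\<phi> (4 powr (min 1 (s - 1) / \<eta>') *
            enn2real (Muckenhoupt_const M \<B> s (\<lambda>x. w x powr (\<theta> * \<eta>))) powr (1 / \<eta>)))"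
  have m: "0 < m" using exps by (simp add: m_def)
  have \<eta>': "0 < \<eta>'"
  proof -
    have "1 / \<eta>' = 1 - 1 / \<eta>" using exps by simp
    also have "\<dots> > 0" using exps by simp
    finally show ?thesis by simp
  qed
  have b_meas [measurable]: "b \<in> borel_measurable M" and "BMO_norm M \<B> b < \<infinity>"
    using b by (auto simp: BMO_def)
  then obtain \<beta> where \<beta>: "0 \<le> \<beta>" "BMO_norm M \<B> b = ennreal \<beta>"
    by (cases "BMO_norm M \<B> b") auto
  have w_meas [measurable]: "w \<in> borel_measurable M" and w_nonneg: "\<And>x. x \<in> space M \<Longrightarrow> 0 \<le> w x"
    using w by (auto simp: weight_def)
  have f_meas [measurable]: "f \<in> borel_measurable M" and "Lp_norm M p (\<lambda>x. w x powr p) f < \<infinity>"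
    using f by (auto simp: Lp_def)
  then obtain A where A: "0 \<le> A" "Lp_norm M p (\<lambda>x. w x powr p) f = ennreal A"
    by (cases "Lp_norm M p (\<lambda>x. w x powr p) f") auto
  have f_int: "(\<integral>\<^sup>+x. ennreal ((w x * norm (f x)) powr p) \<partial>M) \<le> ennreal (A powr p)"
    using A exps w_nonneg by (subst Lp_norm_le_iff[symmetric]) auto

  note good = bounded_for_perturbed_weight[OF basis T_meas exps \<phi>_mono T_bdd w W, folded \<Phi>_def]
  \<comment> \<open>A function whose deviation from \<open>c\<close> is at most
    \<open>m / (\<theta> * \<eta>' * t)\<close> times that of \<open>b\<close> from its average
    meets the exponential condition: the constants cancel and leave \<open>1 / t\<close>.\<close>
  have osc: "\<exists>c. nn_avg M B (\<lambda>x. ennreal (exp (\<theta> * \<eta>' * \<bar>h x - c\<bar> / min 1 (s - 1)))) \<le> 2"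
    if B: "B \<in> \<B>" and t: "\<beta> < t" and lip: "\<And>x. \<bar>h x - c\<bar> \<le> m / (\<theta> * \<eta>' * t) * norm (b x - avg M B b)"
    for B t h c
  proof (intro exI order_trans[OF nn_avg_mono BMO_norm_less_imp_avg_le[OF B]])
    show "BMO_norm M \<B> b < ennreal t" using \<beta> t by (simp add: ennreal_less_iff)
    fix x
    have "\<theta> * \<eta>' * \<bar>h x - c\<bar> / m \<le> \<theta> * \<eta>' * (m / (\<theta> * \<eta>' * t) * norm (b x - avg M B b)) / m"
      using m \<eta>' exps by (intro divide_right_mono mult_left_mono lip) auto
    also have "\<dots> = norm (b x - avg M B b) / t"
      using m \<eta>' exps t \<beta> by (simp add: field_simps)
    finally show "ennreal (exp (\<theta> * \<eta>' * \<bar>h x - c\<bar> / min 1 (s - 1))) \<le> ennreal (exp (norm (b x - avg M B b) / t))"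
      by (simp add: m_def ennreal_leI)
  qed

  have bound: "Lp_norm M q (\<lambda>x. w x powr q) F \<le> ennreal (fact k * (\<eta>' * \<theta> / m) ^ k * \<Phi> * t ^ k * A)"
    if t: "\<beta> < t" for t
  proof -
    \<comment> \<open>A level strictly between \<open>\<beta>\<close> and \<open>t\<close> gives the
      error weight a radius \<open>\<rho> > r\<close> while the oscillation condition still
      holds.\<close>
    define t' where "t' = (\<beta> + t) / 2"
    have t': "\<beta> < t'" "t' < t" "0 < t'" using t \<beta> by (auto simp: t'_def)
    define r where "r = m / (\<theta> * \<eta>' * t)"
    define \<rho> where "\<rho> = m / (\<theta> * \<eta>' * t')"
    have r: "0 < r" "r < \<rho>"
      using m \<eta>' exps t' by (auto simp: r_def \<rho>_def intro!: divide_strict_left_mono mult_strict_left_mono)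
    have "(\<integral>\<^sup>+x. ennreal ((w x * norm (iter_commutator b k \<T> f x)) powr q) \<partial>M)
      \<le> ennreal ((fact k / r ^ k * (\<Phi> * A)) powr q)"
    proof (rule commutator_bound[OF lin T_meas T_norm w_meas w_nonneg b_meas _ exps(2) r _ A(1) _ _ f_meas f_int])
      show "0 \<le> \<Phi>" by (simp add: \<Phi>_def)
      show "0 < p" using exps by simp
      show "bounded_for M D T p q \<Phi> (\<lambda>x. w x * exp (- (\<rho> * norm (b x))))"
      proof (rule good)
        show "- 0 \<le> \<rho> * norm (b x)" for x using r by simp
        show "\<exists>c. nn_avg M B (\<lambda>x. ennreal (exp (\<theta> * \<eta>' * \<bar>\<rho> * norm (b x) - c\<bar> / min 1 (s - 1)))) \<le> 2"
          if "B \<in> \<B>" for B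
        proof (rule osc[OF that t'(1)])
          show "\<bar>\<rho> * norm (b x) - \<rho> * norm (avg M B b)\<bar> \<le> m / (\<theta> * \<eta>' * t') * norm (b x - avg M B b)" for x
            using norm_triangle_ineq3[of "b x" "avg M B b"] r
            by (simp add: abs_mult mult_left_mono flip: \<rho>_def right_diff_distrib)
        qed
      qed simp_all
      fix z :: complex and n :: nat assume z: "norm z = r"
      show "bounded_for M D T p q \<Phi> (\<lambda>x. w x * exp (- Re (z * clip (real n) (b x))))"
      proof (rule good)
        show "- (r * real n) \<le> Re (z * clip (real n) (b x))" for x
        proof -
          have "\<bar>Re (z * clip (real n) (b x))\<bar> \<le> norm (z * clip (real n) (b x))" by (rule abs_Re_le_cmod)
          also have "\<dots> \<le> r * real n"
            using r by (auto simp: norm_mult z intro!: mult_left_mono norm_clip_le)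
          finally show ?thesis by linarith
        qed
        \<comment> \<open>The centre comes from the clipped average, not from the average of the
          clipped function, so the Lipschitz bound applies pointwise.\<close>
        show "\<exists>c. nn_avg M B (\<lambda>x. ennreal (exp (\<theta> * \<eta>' * \<bar>Re (z * clip (real n) (b x)) - c\<bar> / min 1 (s - 1)))) \<le> 2"
          if "B \<in> \<B>" for B
        proof (rule osc[OF that t])
          show "\<bar>Re (z * clip (real n) (b x)) - Re (z * clip (real n) (avg M B b))\<bar>
            \<le> m / (\<theta> * \<eta>' * t) * norm (b x - avg M B b)" for x
          proof -
            have "\<bar>Re (z * clip (real n) (b x)) - Re (z * clip (real n) (avg M B b))\<bar>
              \<le> norm (z * (clip (real n) (b x) - clip (real n) (avg M B b)))"
              by (metis abs_Re_le_cmod minus_complex.sel(1) right_diff_distrib)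
            also have "\<dots> \<le> r * norm (b x - avg M B b)"
              using r by (auto simp: norm_mult z intro!: mult_left_mono clip_lipschitz)
            finally show ?thesis by (simp add: r_def)
          qed
        qed
      qed measurable
    qed
    then have "Lp_norm M q (\<lambda>x. w x powr q) F \<le> ennreal (fact k / r ^ k * (\<Phi> * A))"
      using exps r A w_nonneg by (intro Lp_norm_leI) (auto simp: F \<Phi>_def)
    also have "fact k / r ^ k * (\<Phi> * A) = fact k * (\<eta>' * \<theta> / m) ^ k * \<Phi> * t ^ k * A"
    proof -
      have "1 / r = \<eta>' * \<theta> / m * t" by (simp add: r_def mult_ac)
      then have "1 / r ^ k = (\<eta>' * \<theta> / m) ^ k * t ^ k" by (metis power_mult_distrib power_one_over)
      then have "fact k * (1 / r ^ k) * (\<Phi> * A) = fact k * ((\<eta>' * \<theta> / m) ^ k * t ^ k) * (\<Phi> * A)" by simp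
      then show ?thesis by (simp add: mult_ac)
    qed
    finally show ?thesis .
  qed
  \<comment> \<open>Letting \<open>t\<close> decrease to \<open>\<beta>\<close>, instead of taking
    \<open>t = \<beta>\<close>, covers an infimum that is not attained and the case
    \<open>\<beta> = 0\<close>, where the radius would be infinite.\<close>
  have "Lp_norm M q (\<lambda>x. w x powr q) F \<le> ennreal (fact k * (\<eta>' * \<theta> / m) ^ k * \<Phi> * \<beta> ^ k * A)"
  proof (rule tendsto_lowerbound)
    show "((\<lambda>t. ennreal (fact k * (\<eta>' * \<theta> / m) ^ k * \<Phi> * t ^ k * A))
        \<longlongrightarrow> ennreal (fact k * (\<eta>' * \<theta> / m) ^ k * \<Phi> * \<beta> ^ k * A)) (at_right \<beta>)"
      by (intro tendsto_ennrealI tendsto_intros)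
    show "\<forall>\<^sub>F t in at_right \<beta>. Lp_norm M q (\<lambda>x. w x powr q) F \<le> ennreal (fact k * (\<eta>' * \<theta> / m) ^ k * \<Phi> * t ^ k * A)"
      using eventually_at_right_less by eventually_elim (rule bound)
  qed simp
  also have "\<dots> = ennreal (fact k * (\<eta>' * \<theta> / m) ^ k) * ennreal \<Phi> * BMO_norm M \<B> b ^ k * Lp_norm M p (\<lambda>x. w x powr p) f"
    using \<beta> A m \<eta>' exps by (simp add: ennreal_mult ennreal_power \<Phi>_def)
  also have "ennreal \<Phi> = ennreal (\<phi> (4 powr (min 1 (s - 1) / \<eta>') *
            enn2real (Muckenhoupt_const M \<B> s (\<lambda>x. w x powr (\<theta> * \<eta>))) powr (1 / \<eta>)))"
    by (simp add: \<Phi>_def max_def ennreal_neg)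
  finally show ?thesis by (simp add: m_def)
qed

theorem theorem3p17:
  fixes M :: "'a measure" and \<B> :: "'a set set"
    and D :: "('a \<Rightarrow> complex) set"
    and T :: "('a \<Rightarrow> complex) \<Rightarrow> 'a \<Rightarrow> complex"
    and \<T> :: "('a \<Rightarrow> complex) \<Rightarrow> 'a \<Rightarrow> 'v::complex_banach"
    and Tcomm :: "('a \<Rightarrow> complex) \<Rightarrow> nat \<Rightarrow> ('a \<Rightarrow> complex) \<Rightarrow> 'a \<Rightarrow> complex"
    and p q \<theta> s :: real and \<phi> :: "real \<Rightarrow> real"
  assumes basis: "is_basis M \<B>"
    and T_linear_or_linearizable:
      "(linear_operator M D T \<and>
          (\<forall>b k f. Tcomm b k f = iter_commutator b k T f)) \<or>
       (linearization M D \<T> T \<and>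
          (\<forall>b k f. Tcomm b k f = (\<lambda>x. of_real (norm (iter_commutator b k \<T> f x)))))"
    and T_measurable: "\<And>f. f \<in> D \<Longrightarrow> T f \<in> borel_measurable M"
    and exponents: "1 \<le> p" "1 \<le> q" "0 < \<theta>" "1 < s"
    and \<phi>_mono: "mono_on {1..} \<phi>"
    and \<phi>_nonneg: "\<And>t. 1 \<le> t \<Longrightarrow> 0 \<le> \<phi> t"
    and T_bounded:
      "\<And>w f. weight M \<B> w \<Longrightarrow> (\<lambda>x. w x powr \<theta>) \<in> Muckenhoupt M \<B> s \<Longrightarrow>
         f \<in> Lp M p (\<lambda>x. w x powr p) \<Longrightarrow>
         f \<in> D \<and>
         Lp_norm M q (\<lambda>x. w x powr q) (T f) \<le>
           ennreal (\<phi> (enn2real (Muckenhoupt_const M \<B> s (\<lambda>x. w x powr \<theta>)))) *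
           Lp_norm M p (\<lambda>x. w x powr p) f"
  shows "\<forall>b w \<eta> \<eta>' f.
    b \<in> BMO M \<B> \<and> weight M \<B> w \<and> 1 < \<eta> \<and> 1 / \<eta> + 1 / \<eta>' = 1 \<and>
    (\<lambda>x. w x powr (\<theta> * \<eta>)) \<in> Muckenhoupt M \<B> s \<and>
    f \<in> Lp M p (\<lambda>x. w x powr p) \<longrightarrow>
      Lp_norm M q (\<lambda>x. w x powr q) (Tcomm b 1 f) \<le>
        ennreal (\<eta>' * \<theta> / min 1 (s - 1)) *
        ennreal (\<phi> (4 powr (min 1 (s - 1) / \<eta>') *
          enn2real (Muckenhoupt_const M \<B> s (\<lambda>x. w x powr (\<theta> * \<eta>))) powr (1 / \<eta>))) *
        BMO_norm M \<B> b *
        Lp_norm M p (\<lambda>x. w x powr p) f \<and>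
      (\<forall>k\<ge>2.
        Lp_norm M q (\<lambda>x. w x powr q) (Tcomm b k f) \<le>
          ennreal (fact k * (\<eta>' * \<theta> / min 1 (s - 1)) ^ k) *
          ennreal (\<phi> (4 powr (min 1 (s - 1) / \<eta>') *
            enn2real (Muckenhoupt_const M \<B> s (\<lambda>x. w x powr (\<theta> * \<eta>))) powr (1 / \<eta>))) *
          BMO_norm M \<B> b ^ k *
          Lp_norm M p (\<lambda>x. w x powr p) f)"
proof (intro allI impI)
  fix b w \<eta> \<eta>' f
  assume hyps: "b \<in> BMO M \<B> \<and> weight M \<B> w \<and> 1 < \<eta> \<and> 1 / \<eta> + 1 / \<eta>' = 1 \<and>
    (\<lambda>x. w x powr (\<theta> * \<eta>)) \<in> Muckenhoupt M \<B> s \<and> f \<in> Lp M p (\<lambda>x. w x powr p)"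
  have bound: "Lp_norm M q (\<lambda>x. w x powr q) (Tcomm b k f) \<le>
          ennreal (fact k * (\<eta>' * \<theta> / min 1 (s - 1)) ^ k) *
          ennreal (\<phi> (4 powr (min 1 (s - 1) / \<eta>') *
            enn2real (Muckenhoupt_const M \<B> s (\<lambda>x. w x powr (\<theta> * \<eta>))) powr (1 / \<eta>))) *
          BMO_norm M \<B> b ^ k *
          Lp_norm M p (\<lambda>x. w x powr p) f" for k
    using T_linear_or_linearizable
  proof
    assume lin: "linear_operator M D T \<and> (\<forall>b k f. Tcomm b k f = iter_commutator b k T f)"
    \<comment> \<open>A linear \<open>T\<close> serves as its own \<open>\<T>\<close>, with the
      complex numbers as Banach space.\<close>
    show ?thesis
      by (rule Lp_norm_commutator_le[OF basis conjunct1[OF lin] _ T_measurable exponents _ _ \<phi>_mono T_bounded])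
        (use hyps lin in auto)
  next
    assume lin: "linearization M D \<T> T \<and>
          (\<forall>b k f. Tcomm b k f = (\<lambda>x. of_real (norm (iter_commutator b k \<T> f x))))"
    have "AE x in M. norm (\<T> g x) = norm (T g x)" if "g \<in> D" for g
    proof -
      have "AE x in M. T g x = of_real (norm (\<T> g x))" using lin that by (auto simp: linearization_def)
      then show ?thesis by eventually_elim simp
    qed
    then show ?thesis
      by (intro Lp_norm_commutator_le[where \<T> = \<T>, OF basis _ _ T_measurable exponents _ _ \<phi>_mono T_bounded])
        (use hyps lin in \<open>auto simp: linearization_def\<close>)
  qed
  show "Lp_norm M q (\<lambda>x. w x powr q) (Tcomm b 1 f) \<le>
        ennreal (\<eta>' * \<theta> / min 1 (s - 1)) *
        ennreal (\<phi> (4 powr (min 1 (s - 1) / \<eta>') *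
          enn2real (Muckenhoupt_const M \<B> s (\<lambda>x. w x powr (\<theta> * \<eta>))) powr (1 / \<eta>))) *
        BMO_norm M \<B> b *
        Lp_norm M p (\<lambda>x. w x powr p) f \<and>
      (\<forall>k\<ge>2.
        Lp_norm M q (\<lambda>x. w x powr q) (Tcomm b k f) \<le>
          ennreal (fact k * (\<eta>' * \<theta> / min 1 (s - 1)) ^ k) *
          ennreal (\<phi> (4 powr (min 1 (s - 1) / \<eta>') *
            enn2real (Muckenhoupt_const M \<B> s (\<lambda>x. w x powr (\<theta> * \<eta>))) powr (1 / \<eta>))) *
          BMO_norm M \<B> b ^ k *
          Lp_norm M p (\<lambda>x. w x powr p) f)"
    using bound[of 1] bound by simp
qed

end
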